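(* Let $\{W,\widetilde W,Z\}$ be a data set for an LTONP interpolation problem, with $W:\ell^2_+(\mathcal Y)\to\mathcal Z$, $\widetilde W:\ell^2_+(\mathcal U)\to\mathcal Z$, $Z:\mathcal Z\to\mathcal Z$, and assume that $\Lambda=WW^*-\widetilde W\widetilde W^*$ is strictly positive. Then $P=WW^*$ is strictly positive and the operator $$A=W^*P^{-1}\widetilde W:\ell^2_+(\mathcal U)\to\ell^2_+(\mathcal Y)$$ is a strict contraction. Let $C:\mathcal Z\to\mathcal E$ and $D:\mathcal Y\to\mathcal E$ form an admissible pair of complementary operators determined by the data set, put $B=WE_{\mathcal Y}$, $\widetilde B=\widetilde WE_{\mathcal U}$, and let $$Q_\circ=\bigl(I_{\mathcal E}+CP(\Lambda^{-1}-P^{-1})PC^*\bigr)^{-1/2},\qquad R_\circ=\bigl(I_{\mathcal U}+\widetilde B^*\Lambda^{-1}\widetilde B\bigr)^{-1/2},$$ and for $\lambda\in\mathbb D$ \begin{align*} \Upsilon_{11}(\lambda)&=D^*Q_\circ+\lambda B^*(I-\lambda Z^* )^{-1}\Lambda^{-1}PC^*Q_\circ, & \Upsilon_{12}(\lambda)&=B^*(I-\lambda Z^* )^{-1}\Lambda^{-1}\widetilde BR_\circ,\\ \Upsilon_{21}(\lambda)&=\lambda\widetilde B^*(I-\lambda Z^* )^{-1}\Lambda^{-1}PC^*Q_\circ, & \Upsilon_{22}(\lambda)&=R_\circ+\widetilde B^*(I-\lambda Z^* )^{-1}\Lambda^{-1}\widetilde BR_\circ . \end{align*} Then these functions are also given,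 for $\lambda\in\mathbb D$, by \begin{align*} \Upsilon_{11}(\lambda)&=D^*Q_\circ+\lambda E_{\mathcal Y}^*(I-\lambda S_{\mathcal Y}^* )^{-1}(I-AA^* )^{-1}W^*C^*Q_\circ,\\ \Upsilon_{12}(\lambda)&=E_{\mathcal Y}^*(I-\lambda S_{\mathcal Y}^* )^{-1}A(I-A^*A)^{-1}E_{\mathcal U}R_\circ,\\ \Upsilon_{21}(\lambda)&=\lambda E_{\mathcal U}^*(I-\lambda S_{\mathcal U}^* )^{-1}A^*(I-AA^* )^{-1}W^*C^*Q_\circ,\\ \Upsilon_{22}(\lambda)&=E_{\mathcal U}^*(I-\lambda S_{\mathcal U}^* )^{-1}(I-A^*A)^{-1}E_{\mathcal U}R_\circ, \end{align*} and the strictly positive operators $Q_\circ$ and $R_\circ$ are also given by $$Q_\circ=\bigl(I_{\mathcal E}+CWA(I-A^*A)^{-1}A^*W^*C^*\bigr)^{-1/2},\qquad R_\circ=\bigl(E_{\mathcal U}^*(I-A^*A)^{-1}E_{\mathcal U}\bigr)^{-1/2}.$$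
   Context: All spaces are complex Hilbert spaces and "operator" means bounded linear operator. An operator $T$ on a Hilbert space is strictly positive if $T\ge 0$ and $T$ is invertible. A strict contraction is an operator of norm strictly less than one. $\mathbb D$ is the open unit disc. For a Hilbert space $\mathcal V$, $\ell^2_+(\mathcal V)$ is the space of square summable unilateral sequences in $\mathcal V$, $S_{\mathcal V}$ is the unilateral forward shift on it, and $E_{\mathcal V}:\mathcal V\to\ell^2_+(\mathcal V)$, $E_{\mathcal V}v=(v,0,0,\dots)$. An LTONP (left tangential operator Nevanlinna-Pick) data set is a triple of operators $Z:\mathcal Z\to\mathcal Z$, $W:\ell^2_+(\mathcal Y)\to\mathcal Z$, $\widetilde W:\ell^2_+(\mathcal U)\to\mathcal Z$ with $ZW=WS_{\mathcal Y}$ and $Z\widetilde W=\widetilde WS_{\mathcal U}$. (When $\Lambda$ is strictly positive, $Z^*$ has spectral radius at most one, so $(I-\lambda Z^* )^{-1}$ exists for $\lambda\in\mathbb D$.) Let $P=WW^*$ be strictly positive and $B=WE_{\mathcal Y}$. An admissible pair of complementary operators determined by the data set is a pair $C:\mathcal Z\to\mathcal E$, $D:\mathcal Y\to\mathcal E$ (with $\mathcal E$ some Hilbert space) such that $$\begin{bmatrix} D & C \\ B & Z \end{bmatrix}\begin{bmatrix} I_{\mathcal Y} & 0 \\ 0 & P \end{bmatrix}\begin{bmatrix} D^* & B^* \\ C^* & Z^* \end{bmatrix}=\begin{bmatrix} I_{\mathcal E} & 0 \\ 0 & P \end{bmatrix},\qquad \begin{bmatrix} D^* & B^* \\ C^*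 & Z^* \end{bmatrix}\begin{bmatrix} I_{\mathcal E} & 0 \\ 0 & P^{-1} \end{bmatrix}\begin{bmatrix} D & C \\ B & Z \end{bmatrix}=\begin{bmatrix} I_{\mathcal Y} & 0 \\ 0 & P^{-1} \end{bmatrix}.$$ *)

theory Defs
  imports "HOL-Analysis.Analysis"
begin

section \<open>Complex Hilbert spaces\<close>

class complex_vector = real_vector +
  fixes scaleC :: "complex \<Rightarrow> 'a \<Rightarrow> 'a" (infixr \<open>*\<^sub>C\<close> 75)
  assumes scaleC_add_right: "a *\<^sub>C (x + y) = a *\<^sub>C x + a *\<^sub>C y"
    and scaleC_add_left: "(a + b) *\<^sub>C x = a *\<^sub>C x + b *\<^sub>C x"
    and scaleC_scaleC: "a *\<^sub>C (b *\<^sub>C x) = (a * b) *\<^sub>C x"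
    and scaleR_scaleC: "r *\<^sub>R x = complex_of_real r *\<^sub>C x"

text \<open>The inner product is linear in its first argument. The axiom \<open>cinner_self\<close> says that it
  is positive definite and induces the norm.\<close>

class complex_inner = complex_vector + real_normed_vector +
  fixes cinner :: "'a \<Rightarrow> 'a \<Rightarrow> complex"
  assumes cinner_commute: "cinner x y = cnj (cinner y x)"
    and cinner_add_left: "cinner (x + y) z = cinner x z + cinner y z"
    and cinner_scaleC_left: "cinner (c *\<^sub>C x) y = c * cinner x y"
    and cinner_self: "cinner x x = complex_of_real ((norm x)\<^sup>2)"

class chilbert_space = complex_inner + complete_space

lemma cinner_add_right: "cinner x (y + z) = cinner x y + cinner x z"
  by (metis cinner_add_left cinner_commute complex_cnj_add)

lemma cinner_scaleC_right: "cinner x (c *\<^sub>C y) = cnj c * cinner x y"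
  by (metis cinner_scaleC_left cinner_commute complex_cnj_mult)

lemma norm_scaleC: "norm (c *\<^sub>C x) = cmod c * norm (x :: 'a :: complex_inner)"
proof -
  have "complex_of_real ((norm (c *\<^sub>C x))\<^sup>2) = (c * cnj c) * complex_of_real ((norm x)\<^sup>2)"
    by (simp add: cinner_self[symmetric] cinner_scaleC_left cinner_scaleC_right mult_ac
        del: of_real_power)
  also have "\<dots> = complex_of_real ((cmod c * norm x)\<^sup>2)"
    by (simp add: complex_norm_square[symmetric] power_mult_distrib)
  finally have "(norm (c *\<^sub>C x))\<^sup>2 = (cmod c * norm x)\<^sup>2"
    by (simp only: of_real_eq_iff)
  then show ?thesis
    by (simp add: power2_eq_iff_nonneg)
qed

lemma scaleC_0_right: "a *\<^sub>C (0 :: 'a :: complex_vector) = 0"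
  by (metis add_cancel_right_left scaleC_add_right)

lemma scaleC_minus1: "(-1) *\<^sub>C x = - (x :: 'a :: complex_vector)"
  using scaleR_scaleC[of "-1" x] by simp

lemma norm_cinner_le: "cmod (cinner x y) \<le> (norm x)\<^sup>2 + (norm (y :: 'a :: complex_inner))\<^sup>2"
proof (cases "cinner x y = 0")
  case False
  define u where "u = - (cnj (cinner x y) / cmod (cinner x y))"
  have cu: "cmod u = 1"
    using False by (simp add: u_def norm_divide)
  have uc: "u * cinner x y = - complex_of_real (cmod (cinner x y))"
    using False
    by (simp add: u_def field_simps complex_norm_square[symmetric] power2_eq_square)
  have "complex_of_real ((norm (u *\<^sub>C x + y))\<^sup>2)
      = cinner (u *\<^sub>C x) (u *\<^sub>C x) + u * cinner x y + cnj (u * cinner x y) + cinner y y"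
    unfolding cinner_self[symmetric]
    by (simp add: cinner_add_left cinner_add_right cinner_scaleC_left[of u x y]
        cinner_commute[of y "u *\<^sub>C x"])
  also have "\<dots> = complex_of_real ((norm x)\<^sup>2 - 2 * cmod (cinner x y) + (norm y)\<^sup>2)"
    by (simp add: uc cinner_self norm_scaleC cu)
  finally have "(norm (u *\<^sub>C x + y))\<^sup>2 = (norm x)\<^sup>2 - 2 * cmod (cinner x y) + (norm y)\<^sup>2"
    by (simp only: of_real_eq_iff)
  then have "2 * cmod (cinner x y) \<le> (norm x)\<^sup>2 + (norm y)\<^sup>2"
    by (smt (verit) zero_le_power2)
  then show ?thesis
    by (smt (verit) norm_ge_zero)
qed simp

text \<open>Hilbert direct sums.\<close>

instantiation prod :: (complex_vector, complex_vector) complex_vector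
begin

definition "scaleC_prod c p = (c *\<^sub>C fst p, c *\<^sub>C snd p)"

instance
  by standard
    (auto simp: scaleC_prod_def scaleR_prod_def scaleC_add_right scaleC_add_left scaleC_scaleC
      scaleR_scaleC)

end

instantiation prod :: (complex_inner, complex_inner) complex_inner
begin

definition "cinner_prod p q = cinner (fst p) (fst q) + cinner (snd p) (snd q)"

instance
proof
  fix p q r :: "'a \<times> 'b" and c :: complex
  show "cinner p q = cnj (cinner q p)"
    by (metis cinner_prod_def cinner_commute complex_cnj_add)
  show "cinner (p + q) r = cinner p r + cinner q r"
    by (simp add: cinner_prod_def cinner_add_left)
  show "cinner (c *\<^sub>C p) q = c * cinner p q"
    by (simp add: cinner_prod_def scaleC_prod_def cinner_scaleC_left algebra_simps)
  show "cinner p p = complex_of_real ((norm p)\<^sup>2)"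
    by (simp add: cinner_prod_def cinner_self norm_prod_def)
qed

end

instance prod :: (chilbert_space, chilbert_space) chilbert_space ..


section \<open>Square summable unilateral sequences\<close>

typedef (overloaded) 'a ell2 =
  "{x :: nat \<Rightarrow> 'a :: complex_inner. summable (\<lambda>n. (norm (x n))\<^sup>2)}"
  morphisms ell2_nth Abs_ell2
  by (rule exI[of _ "\<lambda>_. 0"]) simp

setup_lifting type_definition_ell2

lemma summable_ell2: "summable (\<lambda>n. (norm (ell2_nth x n))\<^sup>2)"
  using ell2_nth[of x] by simp

lemma ell2_add_aux:
  fixes x y :: "nat \<Rightarrow> 'a :: real_normed_vector"
  assumes "summable (\<lambda>n. (norm (x n))\<^sup>2)" "summable (\<lambda>n. (norm (y n))\<^sup>2)"
  shows "summable (\<lambda>n. (norm (x n + y n))\<^sup>2) \<and>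
    sqrt (\<Sum>n. (norm (x n + y n))\<^sup>2) \<le> sqrt (\<Sum>n. (norm (x n))\<^sup>2) + sqrt (\<Sum>n. (norm (y n))\<^sup>2)"
proof -
  let ?s = "sqrt (\<Sum>n. (norm (x n))\<^sup>2) + sqrt (\<Sum>n. (norm (y n))\<^sup>2)"
  have s0: "0 \<le> ?s"
    using assms by (simp add: suminf_nonneg)
  have b: "(\<Sum>n<N. (norm (x n + y n))\<^sup>2) \<le> ?s\<^sup>2" for N
  proof -
    have "sqrt (\<Sum>n<N. (norm (x n + y n))\<^sup>2) \<le> L2_set (\<lambda>n. norm (x n) + norm (y n)) {..<N}"
      unfolding L2_set_def
      by (intro real_sqrt_le_mono sum_mono power_mono norm_triangle_ineq norm_ge_zero)
    also have "\<dots> \<le> L2_set (\<lambda>n. norm (x n)) {..<N} + L2_set (\<lambda>n. norm (y n)) {..<N}"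
      by (rule L2_set_triangle_ineq)
    also have "\<dots> \<le> ?s"
      unfolding L2_set_def
      by (intro add_mono real_sqrt_le_mono sum_le_suminf assms) auto
    finally show ?thesis
      by (rule sqrt_le_D)
  qed
  have S: "summable (\<lambda>n. (norm (x n + y n))\<^sup>2)"
    by (rule summableI_nonneg_bounded[OF _ b]) simp
  moreover have "(\<Sum>n. (norm (x n + y n))\<^sup>2) \<le> ?s\<^sup>2"
    by (rule suminf_le_const[OF S b])
  ultimately show ?thesis
    using s0 by (simp add: real_le_lsqrt)
qed

instantiation ell2 :: (complex_inner) complex_vector
begin

lift_definition zero_ell2 :: "'a ell2" is "\<lambda>_. 0"
  by simp
lift_definition plus_ell2 :: "'a ell2 \<Rightarrow> 'a ell2 \<Rightarrow> 'a ell2" is "\<lambda>x y n. x n + y n"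
  by (simp add: ell2_add_aux)
lift_definition uminus_ell2 :: "'a ell2 \<Rightarrow> 'a ell2" is "\<lambda>x n. - x n"
  by simp
lift_definition minus_ell2 :: "'a ell2 \<Rightarrow> 'a ell2 \<Rightarrow> 'a ell2" is "\<lambda>x y n. x n - y n"
proof -
  fix x y :: "nat \<Rightarrow> 'a"
  assume "summable (\<lambda>n. (norm (x n))\<^sup>2)" "summable (\<lambda>n. (norm (y n))\<^sup>2)"
  then show "summable (\<lambda>n. (norm (x n - y n))\<^sup>2)"
    using ell2_add_aux[of x "\<lambda>n. - y n"] by simp
qed
lift_definition scaleC_ell2 :: "complex \<Rightarrow> 'a ell2 \<Rightarrow> 'a ell2" is "\<lambda>c x n. c *\<^sub>C x n"
  by (simp add: norm_scaleC power_mult_distrib summable_mult)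
lift_definition scaleR_ell2 :: "real \<Rightarrow> 'a ell2 \<Rightarrow> 'a ell2" is "\<lambda>c x n. c *\<^sub>R x n"
  by (simp add: power_mult_distrib summable_mult)

instance
  by standard
    (transfer; simp add: fun_eq_iff algebra_simps scaleC_add_right scaleC_add_left scaleC_scaleC;
      simp add: scaleR_scaleC)+

end

instantiation ell2 :: (complex_inner) complex_inner
begin

lift_definition norm_ell2 :: "'a ell2 \<Rightarrow> real" is "\<lambda>x. sqrt (\<Sum>n. (norm (x n))\<^sup>2)" .
lift_definition cinner_ell2 :: "'a ell2 \<Rightarrow> 'a ell2 \<Rightarrow> complex" is "\<lambda>x y. \<Sum>n. cinner (x n) (y n)" .
definition "sgn_ell2 (x :: 'a ell2) = x /\<^sub>R norm x"
definition "dist_ell2 (x :: 'a ell2) y = norm (x - y)"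
definition [code del]: "(uniformity :: ('a ell2 \<times> 'a ell2) filter) =
  (INF e\<in>{0 <..}. principal {(x, y). dist x y < e})"
definition [code del]: "open (U :: 'a ell2 set) \<longleftrightarrow>
  (\<forall>x\<in>U. eventually (\<lambda>(x', y). x' = x \<longrightarrow> y \<in> U) uniformity)"

lemma summable_cinner:
  fixes x y :: "nat \<Rightarrow> 'a"
  assumes "summable (\<lambda>n. (norm (x n))\<^sup>2)" "summable (\<lambda>n. (norm (y n))\<^sup>2)"
  shows "summable (\<lambda>n. cinner (x n) (y n))"
  by (rule summable_comparison_test[OF _ summable_add[OF assms]])
    (auto intro!: norm_cinner_le)

instance
proof
  fix x y z :: "'a ell2" and r :: real and c :: complex
  show "sgn x = x /\<^sub>R norm x"
    by (rule sgn_ell2_def)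
  show "dist x y = norm (x - y)"
    by (rule dist_ell2_def)
  show "(uniformity :: ('a ell2 \<times> 'a ell2) filter) =
      (INF e\<in>{0 <..}. principal {(x, y). dist x y < e})"
    by (rule uniformity_ell2_def)
  show "open U \<longleftrightarrow> (\<forall>x\<in>U. eventually (\<lambda>(x', y). x' = x \<longrightarrow> y \<in> U) uniformity)"
    for U :: "'a ell2 set"
    by (rule open_ell2_def)
  show "norm x = 0 \<longleftrightarrow> x = 0"
    by transfer (auto simp: suminf_eq_zero_iff fun_eq_iff)
  show "norm (x + y) \<le> norm x + norm y"
    by transfer (simp add: ell2_add_aux)
  show "norm (r *\<^sub>R x) = \<bar>r\<bar> * norm x"
    by transfer (simp add: power_mult_distrib suminf_mult real_sqrt_mult)
  show "cinner x y = cnj (cinner y x)"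
  proof transfer
    fix x y :: "nat \<Rightarrow> 'a"
    assume "summable (\<lambda>n. (norm (x n))\<^sup>2)" "summable (\<lambda>n. (norm (y n))\<^sup>2)"
    then have "(\<lambda>n. cinner (y n) (x n)) sums (\<Sum>n. cinner (y n) (x n))"
      by (intro summable_sums summable_cinner)
    then have "(\<lambda>n. cnj (cinner (y n) (x n))) sums cnj (\<Sum>n. cinner (y n) (x n))"
      by (simp only: sums_cnj)
    then show "(\<Sum>n. cinner (x n) (y n)) = cnj (\<Sum>n. cinner (y n) (x n))"
      by (simp add: cinner_commute[symmetric] sums_unique[symmetric])
  qed
  show "cinner (x + y) z = cinner x z + cinner y z"
    by transfer (simp add: cinner_add_left suminf_add summable_cinner)
  show "cinner (c *\<^sub>C x) y = c * cinner x y"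
    by transfer (simp add: cinner_scaleC_left suminf_mult summable_cinner)
  show "cinner x x = complex_of_real ((norm x)\<^sup>2)"
    by transfer
      (simp add: cinner_self suminf_nonneg suminf_of_real[symmetric] del: of_real_power)
qed

end

lemma norm_ell2_nth_le: "norm (ell2_nth x n) \<le> norm x"
proof -
  have "(\<Sum>i\<in>{n}. (norm (ell2_nth x i))\<^sup>2) \<le> (\<Sum>i. (norm (ell2_nth x i))\<^sup>2)"
    by (rule sum_le_suminf[OF summable_ell2]) auto
  then show ?thesis
    by (simp add: norm_ell2.rep_eq real_le_rsqrt)
qed

instance ell2 :: (chilbert_space) chilbert_space
proof
  fix X :: "nat \<Rightarrow> 'a ell2"
  assume X: "Cauchy X"
  have "Cauchy (\<lambda>k. ell2_nth (X k) i)" for i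
  proof (rule metric_CauchyI)
    fix e :: real assume "0 < e"
    then obtain M where "\<forall>m\<ge>M. \<forall>n\<ge>M. dist (X m) (X n) < e"
      using X by (meson metric_CauchyD)
    then show "\<exists>M. \<forall>m\<ge>M. \<forall>n\<ge>M. dist (ell2_nth (X m) i) (ell2_nth (X n) i) < e"
      by (metis dist_norm minus_ell2.rep_eq norm_ell2_nth_le order.strict_trans1)
  qed
  then have "\<exists>l. (\<lambda>k. ell2_nth (X k) i) \<longlonglongrightarrow> l" for i
    by (simp add: Cauchy_convergent_iff convergent_def)
  then obtain l where l: "(\<lambda>k. ell2_nth (X k) i) \<longlonglongrightarrow> l i" for i
    by metis
  have tail: "\<exists>M. \<forall>m\<ge>M. \<forall>N. (\<Sum>i<N. (norm (ell2_nth (X m) i - l i))\<^sup>2) \<le> e\<^sup>2"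
    if e: "0 < e" for e
  proof -
    obtain M where M: "\<And>m n. m \<ge> M \<Longrightarrow> n \<ge> M \<Longrightarrow> norm (X m - X n) < e"
      using X e by (metis metric_CauchyD dist_norm)
    have "(\<Sum>i<N. (norm (ell2_nth (X m) i - l i))\<^sup>2) \<le> e\<^sup>2" if m: "m \<ge> M" for m N
    proof (rule LIMSEQ_le_const2)
      show "(\<lambda>n. \<Sum>i<N. (norm (ell2_nth (X m) i - ell2_nth (X n) i))\<^sup>2)
          \<longlonglongrightarrow> (\<Sum>i<N. (norm (ell2_nth (X m) i - l i))\<^sup>2)"
        by (intro tendsto_intros l)
      have "(\<Sum>i<N. (norm (ell2_nth (X m) i - ell2_nth (X n) i))\<^sup>2) \<le> e\<^sup>2" if "n \<ge> M" for n
      proof -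
        have "(\<Sum>i<N. (norm (ell2_nth (X m - X n) i))\<^sup>2) \<le> (\<Sum>i. (norm (ell2_nth (X m - X n) i))\<^sup>2)"
          by (rule sum_le_suminf[OF summable_ell2]) auto
        also have "\<dots> = (norm (X m - X n))\<^sup>2"
          by (simp add: norm_ell2.rep_eq suminf_nonneg summable_ell2)
        also have "\<dots> \<le> e\<^sup>2"
          using M[OF m that] by (intro power_mono) auto
        finally show ?thesis
          by (simp add: minus_ell2.rep_eq)
      qed
      then show "\<exists>K. \<forall>n\<ge>K. (\<Sum>i<N. (norm (ell2_nth (X m) i - ell2_nth (X n) i))\<^sup>2) \<le> e\<^sup>2"
        by blast
    qed
    then show ?thesis by blast
  qed
  obtain M where "\<forall>N. (\<Sum>i<N. (norm (ell2_nth (X M) i - l i))\<^sup>2) \<le> 1\<^sup>2"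
    using tail[of 1] by auto
  then have "summable (\<lambda>i. (norm (ell2_nth (X M) i - l i))\<^sup>2)"
    by (intro summableI_nonneg_bounded[where x = "1\<^sup>2"]) auto
  then have "summable (\<lambda>i. (norm (- (ell2_nth (X M) i - l i) + ell2_nth (X M) i))\<^sup>2)"
    by (intro conjunct1[OF ell2_add_aux] summable_ell2) (simp only: norm_minus_cancel)
  then have L: "ell2_nth (Abs_ell2 l) = l"
    by (intro Abs_ell2_inverse) simp
  have "X \<longlonglongrightarrow> Abs_ell2 l"
  proof (rule metric_LIMSEQ_I)
    fix e :: real assume e: "0 < e"
    obtain M where M: "\<forall>m\<ge>M. \<forall>N. (\<Sum>i<N. (norm (ell2_nth (X m) i - l i))\<^sup>2) \<le> (e/2)\<^sup>2"
      using tail[of "e/2"] e by auto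
    have "dist (X m) (Abs_ell2 l) < e" if "m \<ge> M" for m
    proof -
      have "(\<Sum>i. (norm (ell2_nth (X m - Abs_ell2 l) i))\<^sup>2) \<le> (e/2)\<^sup>2"
        by (rule suminf_le_const[OF summable_ell2]) (use M that in \<open>simp add: minus_ell2.rep_eq L\<close>)
      then have "norm (X m - Abs_ell2 l) \<le> e/2"
        unfolding norm_ell2.rep_eq using e by (intro real_le_lsqrt) auto
      then show ?thesis
        using e by (simp add: dist_norm)
    qed
    then show "\<exists>M. \<forall>m\<ge>M. dist (X m) (Abs_ell2 l) < e"
      by blast
  qed
  then show "convergent X"
    by (rule convergentI)
qed


section \<open>Bounded linear operators\<close>

definition bounded_clinear :: "('a :: complex_inner \<Rightarrow> 'b :: complex_inner) \<Rightarrow> bool" where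
  "bounded_clinear f \<longleftrightarrow> bounded_linear f \<and> (\<forall>c x. f (c *\<^sub>C x) = c *\<^sub>C f x)"

typedef (overloaded) ('a, 'b) cblinfun (\<open>(_ \<Rightarrow>\<^sub>C\<^sub>L /_)\<close> [22, 21] 21) =
  "{f :: 'a :: complex_inner \<Rightarrow> 'b :: complex_inner. bounded_clinear f}"
  morphisms cblinfun_apply Abs_cblinfun
  by (rule exI[of _ "\<lambda>_. 0"]) (simp add: bounded_clinear_def bounded_linear_zero scaleC_0_right)

setup_lifting type_definition_cblinfun

lemma bounded_clinear_scaleC: "bounded_clinear (\<lambda>x. c *\<^sub>C x :: 'a :: complex_inner)"
  unfolding bounded_clinear_def
  by (auto intro!: bounded_linear_intro[where K = "cmod c"]
      simp: scaleC_add_right scaleR_scaleC scaleC_scaleC norm_scaleC mult.commute)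

lemma bounded_clinear_compose:
  "bounded_clinear f \<Longrightarrow> bounded_clinear g \<Longrightarrow> bounded_clinear (\<lambda>x. f (g x))"
  by (simp add: bounded_clinear_def bounded_linear_compose)

lemma bounded_clinear_add:
  "bounded_clinear f \<Longrightarrow> bounded_clinear g \<Longrightarrow> bounded_clinear (\<lambda>x. f x + g x)"
  by (simp add: bounded_clinear_def bounded_linear_add scaleC_add_right)

instantiation cblinfun :: (complex_inner, complex_inner) complex_vector
begin

lift_definition zero_cblinfun :: "'a \<Rightarrow>\<^sub>C\<^sub>L 'b" is "\<lambda>_. 0"
  by (simp add: bounded_clinear_def bounded_linear_zero scaleC_0_right)
lift_definition plus_cblinfun :: "('a \<Rightarrow>\<^sub>C\<^sub>L 'b) \<Rightarrow> ('a \<Rightarrow>\<^sub>C\<^sub>L 'b) \<Rightarrow> 'a \<Rightarrow>\<^sub>C\<^sub>L 'b" is "\<lambda>f g x. f x + g x"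
  by (rule bounded_clinear_add)
lift_definition scaleC_cblinfun :: "complex \<Rightarrow> ('a \<Rightarrow>\<^sub>C\<^sub>L 'b) \<Rightarrow> 'a \<Rightarrow>\<^sub>C\<^sub>L 'b" is "\<lambda>c f x. c *\<^sub>C f x"
  by (rule bounded_clinear_compose[OF bounded_clinear_scaleC])
lift_definition scaleR_cblinfun :: "real \<Rightarrow> ('a \<Rightarrow>\<^sub>C\<^sub>L 'b) \<Rightarrow> 'a \<Rightarrow>\<^sub>C\<^sub>L 'b" is "\<lambda>c f x. c *\<^sub>R f x"
  unfolding scaleR_scaleC by (rule bounded_clinear_compose[OF bounded_clinear_scaleC])
lift_definition uminus_cblinfun :: "('a \<Rightarrow>\<^sub>C\<^sub>L 'b) \<Rightarrow> 'a \<Rightarrow>\<^sub>C\<^sub>L 'b" is "\<lambda>f x. - f x"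
  by (drule bounded_clinear_compose[OF bounded_clinear_scaleC[of "-1"]]) (simp add: scaleC_minus1)
lift_definition minus_cblinfun :: "('a \<Rightarrow>\<^sub>C\<^sub>L 'b) \<Rightarrow> ('a \<Rightarrow>\<^sub>C\<^sub>L 'b) \<Rightarrow> 'a \<Rightarrow>\<^sub>C\<^sub>L 'b" is "\<lambda>f g x. f x - g x"
proof -
  fix f g :: "'a \<Rightarrow> 'b"
  assume "bounded_clinear f" "bounded_clinear g"
  then have "bounded_clinear (\<lambda>x. f x + (-1) *\<^sub>C g x)"
    by (intro bounded_clinear_add bounded_clinear_compose[OF bounded_clinear_scaleC])
  then show "bounded_clinear (\<lambda>x. f x - g x)"
    by (simp add: scaleC_minus1)
qed

instance
  by standard
    (transfer; simp add: fun_eq_iff algebra_simps scaleC_add_right scaleC_add_left scaleC_scaleC;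
      simp add: scaleR_scaleC)+

end

instantiation cblinfun :: (complex_inner, complex_inner) real_normed_vector
begin

lift_definition norm_cblinfun :: "('a \<Rightarrow>\<^sub>C\<^sub>L 'b) \<Rightarrow> real" is onorm .
definition "sgn_cblinfun (T :: 'a \<Rightarrow>\<^sub>C\<^sub>L 'b) = T /\<^sub>R norm T"
definition "dist_cblinfun (S :: 'a \<Rightarrow>\<^sub>C\<^sub>L 'b) T = norm (S - T)"
definition [code del]: "(uniformity :: (('a \<Rightarrow>\<^sub>C\<^sub>L 'b) \<times> ('a \<Rightarrow>\<^sub>C\<^sub>L 'b)) filter) =
  (INF e\<in>{0 <..}. principal {(x, y). dist x y < e})"
definition [code del]: "open (U :: ('a \<Rightarrow>\<^sub>C\<^sub>L 'b) set) \<longleftrightarrow>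
  (\<forall>x\<in>U. eventually (\<lambda>(x', y). x' = x \<longrightarrow> y \<in> U) uniformity)"

instance
proof
  fix S T :: "'a \<Rightarrow>\<^sub>C\<^sub>L 'b" and r :: real
  show "sgn S = S /\<^sub>R norm S"
    by (rule sgn_cblinfun_def)
  show "dist S T = norm (S - T)"
    by (rule dist_cblinfun_def)
  show "(uniformity :: (('a \<Rightarrow>\<^sub>C\<^sub>L 'b) \<times> ('a \<Rightarrow>\<^sub>C\<^sub>L 'b)) filter) =
      (INF e\<in>{0 <..}. principal {(x, y). dist x y < e})"
    by (rule uniformity_cblinfun_def)
  show "open U \<longleftrightarrow> (\<forall>x\<in>U. eventually (\<lambda>(x', y). x' = x \<longrightarrow> y \<in> U) uniformity)"
    for U :: "('a \<Rightarrow>\<^sub>C\<^sub>L 'b) set"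
    by (rule open_cblinfun_def)
  show "norm S = 0 \<longleftrightarrow> S = 0"
    by transfer (auto simp: bounded_clinear_def onorm_eq_0)
  show "norm (S + T) \<le> norm S + norm T"
    by transfer (auto simp: bounded_clinear_def intro: onorm_triangle)
  show "norm (r *\<^sub>R S) = \<bar>r\<bar> * norm S"
    by transfer (auto simp: bounded_clinear_def onorm_scaleR)
qed

end

lift_definition cblinfun_compose ::
  "('b :: complex_inner \<Rightarrow>\<^sub>C\<^sub>L 'c :: complex_inner) \<Rightarrow> ('a :: complex_inner \<Rightarrow>\<^sub>C\<^sub>L 'b) \<Rightarrow> 'a \<Rightarrow>\<^sub>C\<^sub>L 'c"
  (infixl \<open>o\<^sub>C\<close> 67) is "\<lambda>f g x. f (g x)"
  by (rule bounded_clinear_compose)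

lift_definition id_cblinfun :: "'a :: complex_inner \<Rightarrow>\<^sub>C\<^sub>L 'a" is "\<lambda>x. x"
  by (simp add: bounded_clinear_def bounded_linear_ident)

text \<open>Between Hilbert spaces the adjoint exists and is unique by the Riesz representation
  theorem.\<close>

definition cadjoint :: "('a :: chilbert_space \<Rightarrow>\<^sub>C\<^sub>L 'b :: chilbert_space) \<Rightarrow> 'b \<Rightarrow>\<^sub>C\<^sub>L 'a"
  (\<open>_\<^sup>\<dagger>\<close> [1000] 1000) where
  "T\<^sup>\<dagger> = (THE S. \<forall>x y. cinner (cblinfun_apply S x) y = cinner x (cblinfun_apply T y))"

definition op_invertible :: "('a :: chilbert_space \<Rightarrow>\<^sub>C\<^sub>L 'b :: chilbert_space) \<Rightarrow> bool" where
  "op_invertible T \<longleftrightarrow> (\<exists>S. S o\<^sub>C T = id_cblinfun \<and> T o\<^sub>C S = id_cblinfun)"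

text \<open>The inverse is meaningful only for operators satisfying \<^const>\<open>op_invertible\<close>.\<close>

definition op_inv :: "('a :: chilbert_space \<Rightarrow>\<^sub>C\<^sub>L 'b :: chilbert_space) \<Rightarrow> 'b \<Rightarrow>\<^sub>C\<^sub>L 'a" where
  "op_inv T = (THE S. S o\<^sub>C T = id_cblinfun \<and> T o\<^sub>C S = id_cblinfun)"

text \<open>On a complex Hilbert space, nonnegativity of the quadratic form already implies
  selfadjointness.\<close>

definition positive_op :: "('a :: chilbert_space \<Rightarrow>\<^sub>C\<^sub>L 'a) \<Rightarrow> bool" where
  "positive_op T \<longleftrightarrow> (\<forall>x. cinner (cblinfun_apply T x) x \<in> \<real>\<^sub>\<ge>\<^sub>0)"

definition strictly_positive :: "('a :: chilbert_space \<Rightarrow>\<^sub>C\<^sub>L 'a) \<Rightarrow> bool" where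
  "strictly_positive T \<longleftrightarrow> positive_op T \<and> op_invertible T"

text \<open>The square root is meaningful only for operators satisfying \<^const>\<open>positive_op\<close>.\<close>

definition op_sqrt :: "('a :: chilbert_space \<Rightarrow>\<^sub>C\<^sub>L 'a) \<Rightarrow> 'a \<Rightarrow>\<^sub>C\<^sub>L 'a" where
  "op_sqrt T = (THE S. positive_op S \<and> S o\<^sub>C S = T)"

definition op_inv_sqrt :: "('a :: chilbert_space \<Rightarrow>\<^sub>C\<^sub>L 'a) \<Rightarrow> 'a \<Rightarrow>\<^sub>C\<^sub>L 'a" where
  "op_inv_sqrt T = op_inv (op_sqrt T)"

text \<open>The operator with block matrix rows \<open>T11, T12\<close> and \<open>T21, T22\<close>.\<close>

lift_definition op_block ::
  "('a :: complex_inner \<Rightarrow>\<^sub>C\<^sub>L 'c :: complex_inner) \<Rightarrow> ('b :: complex_inner \<Rightarrow>\<^sub>C\<^sub>L 'c) \<Rightarrow>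
   ('a \<Rightarrow>\<^sub>C\<^sub>L 'd :: complex_inner) \<Rightarrow> ('b \<Rightarrow>\<^sub>C\<^sub>L 'd) \<Rightarrow> ('a \<times> 'b) \<Rightarrow>\<^sub>C\<^sub>L ('c \<times> 'd)" is
  "\<lambda>T11 T12 T21 T22 p. (T11 (fst p) + T12 (snd p), T21 (fst p) + T22 (snd p))"
  unfolding bounded_clinear_def
  by (auto simp: scaleC_prod_def scaleC_add_right
      intro!: bounded_linear_Pair bounded_linear_add bounded_linear_compose[OF _ bounded_linear_fst]
        bounded_linear_compose[OF _ bounded_linear_snd])


section \<open>Forward shift and embedding on the sequence spaces\<close>

lift_definition ell2_shift_fun :: "'a :: complex_inner ell2 \<Rightarrow> 'a ell2" is
  "\<lambda>x n. case n of 0 \<Rightarrow> 0 | Suc m \<Rightarrow> x m"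
  by (subst summable_Suc_iff[symmetric]) simp

lift_definition ell2_embed_fun :: "'a :: complex_inner \<Rightarrow> 'a ell2" is
  "\<lambda>v n. if n = 0 then v else 0"
  by (subst summable_Suc_iff[symmetric]) simp

lemma norm_ell2_shift_fun: "norm (ell2_shift_fun x) = norm x"
proof transfer
  fix x :: "nat \<Rightarrow> 'a"
  assume "summable (\<lambda>n. (norm (x n))\<^sup>2)"
  then have "summable (\<lambda>n. (norm (case n of 0 \<Rightarrow> 0 | Suc m \<Rightarrow> x m))\<^sup>2)"
    by (subst summable_Suc_iff[symmetric]) simp
  from suminf_split_head[OF this]
  show "sqrt (\<Sum>n. (norm (case n of 0 \<Rightarrow> 0 | Suc m \<Rightarrow> x m))\<^sup>2) = sqrt (\<Sum>n. (norm (x n))\<^sup>2)"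
    by simp
qed

lemma norm_ell2_embed_fun: "norm (ell2_embed_fun v) = norm v"
proof transfer
  fix v :: 'a
  have "(\<Sum>n. (norm (if n = 0 then v else 0))\<^sup>2) = (\<Sum>n\<in>{0::nat}. (norm (if n = 0 then v else 0))\<^sup>2)"
    by (rule suminf_finite) auto
  then show "sqrt (\<Sum>n::nat. (norm (if n = 0 then v else 0))\<^sup>2) = norm v"
    by simp
qed

lift_definition ell2_shift :: "'a :: complex_inner ell2 \<Rightarrow>\<^sub>C\<^sub>L 'a ell2" is ell2_shift_fun
  unfolding bounded_clinear_def
proof (intro conjI allI)
  show "bounded_linear (ell2_shift_fun :: 'a ell2 \<Rightarrow> 'a ell2)"
    by (rule bounded_linear_intro[where K = 1]; (simp add: norm_ell2_shift_fun)?;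
        transfer; simp add: fun_eq_iff split: nat.split)
  show "ell2_shift_fun (c *\<^sub>C x) = c *\<^sub>C ell2_shift_fun x" for c and x :: "'a ell2"
    by transfer (simp add: fun_eq_iff scaleC_0_right split: nat.split)
qed

lift_definition ell2_embed :: "'a :: complex_inner \<Rightarrow>\<^sub>C\<^sub>L 'a ell2" is ell2_embed_fun
  unfolding bounded_clinear_def
proof (intro conjI allI)
  show "bounded_linear (ell2_embed_fun :: 'a \<Rightarrow> 'a ell2)"
    by (rule bounded_linear_intro[where K = 1]; (simp add: norm_ell2_embed_fun)?;
        transfer; simp add: fun_eq_iff)
  show "ell2_embed_fun (c *\<^sub>C v) = c *\<^sub>C ell2_embed_fun v" for c and v :: 'a
    by transfer (simp add: fun_eq_iff scaleC_0_right)
qed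


section \<open>LTONP data sets and admissible pairs\<close>

definition LTONP_data_set ::
  "('y :: chilbert_space ell2 \<Rightarrow>\<^sub>C\<^sub>L 'z :: chilbert_space) \<Rightarrow> ('u :: chilbert_space ell2 \<Rightarrow>\<^sub>C\<^sub>L 'z) \<Rightarrow>
   ('z \<Rightarrow>\<^sub>C\<^sub>L 'z) \<Rightarrow> bool" where
  "LTONP_data_set W Wt Z \<longleftrightarrow> Z o\<^sub>C W = W o\<^sub>C ell2_shift \<and> Z o\<^sub>C Wt = Wt o\<^sub>C ell2_shift"

text \<open>The pair depends on the data set only through \<open>W\<close> and \<open>Z\<close>; the notion is used only when
  \<open>W W\<^sup>\<dagger>\<close> is strictly positive.\<close>

definition admissible_pair ::
  "('y :: chilbert_space ell2 \<Rightarrow>\<^sub>C\<^sub>L 'z :: chilbert_space) \<Rightarrow> ('z \<Rightarrow>\<^sub>C\<^sub>L 'z) \<Rightarrow>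
   ('z \<Rightarrow>\<^sub>C\<^sub>L 'e :: chilbert_space) \<Rightarrow> ('y \<Rightarrow>\<^sub>C\<^sub>L 'e) \<Rightarrow> bool" where
  "admissible_pair W Z C D \<longleftrightarrow>
    (let P = W o\<^sub>C W\<^sup>\<dagger>; B = W o\<^sub>C ell2_embed in
      op_block D C B Z o\<^sub>C op_block id_cblinfun 0 0 P o\<^sub>C op_block (D\<^sup>\<dagger>) (B\<^sup>\<dagger>) (C\<^sup>\<dagger>) (Z\<^sup>\<dagger>)
        = op_block id_cblinfun 0 0 P \<and>
      op_block (D\<^sup>\<dagger>) (B\<^sup>\<dagger>) (C\<^sup>\<dagger>) (Z\<^sup>\<dagger>) o\<^sub>C op_block id_cblinfun 0 0 (op_inv P) o\<^sub>C op_block D C B Z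
        = op_block id_cblinfun 0 0 (op_inv P))"

end

theory Submission
  imports Defs
begin

text \<open>The intertwining relations give \<open>W\<^sup>\<dagger> (I - \<zeta> Z\<^sup>\<dagger>)\<^sup>-\<^sup>1 = (I - \<zeta> S\<^sup>\<dagger>)\<^sup>-\<^sup>1 W\<^sup>\<dagger>\<close>, and likewise for
  \<open>Wt\<close>, so everything reduces to the two resolvent identities
  \<open>(I - A A\<^sup>\<dagger>)\<^sup>-\<^sup>1 = I + W\<^sup>\<dagger> (\<Lambda>\<^sup>-\<^sup>1 - P\<^sup>-\<^sup>1) W\<close> and \<open>(I - A\<^sup>\<dagger> A)\<^sup>-\<^sup>1 = I + Wt\<^sup>\<dagger> \<Lambda>\<^sup>-\<^sup>1 Wt\<close>, which are pure
  algebra from \<open>W W\<^sup>\<dagger> = P\<close> and \<open>Wt Wt\<^sup>\<dagger> = P - \<Lambda>\<close>. The second one shows that \<open>I - A\<^sup>\<dagger> A\<close> is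
  strictly positive, hence \<open>norm A < 1\<close>. All invertibility statements come from coercivity:
  strictly positive operators are coercive, and \<open>P (I - \<zeta> Z\<^sup>\<dagger>)\<close> is coercive because
  \<open>W\<^sup>\<dagger> Z\<^sup>\<dagger> = S\<^sup>\<dagger> W\<^sup>\<dagger>\<close> with \<open>S\<^sup>\<dagger>\<close> contractive.\<close>

declare [[coercion cblinfun_apply]]

section \<open>Inner products\<close>

lemma cinner_zero_left [simp]: "cinner 0 (x :: 'a :: complex_inner) = 0"
  using cinner_add_left[of 0 0 x] by simp

lemma cinner_zero_right [simp]: "cinner (x :: 'a :: complex_inner) 0 = 0"
  using cinner_add_right[of x 0 0] by simp

lemma cinner_diff_left: "cinner (x - y) z = cinner x z - cinner y (z :: 'a :: complex_inner)"
  using cinner_add_left[of "x - y" y z] by simp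

lemma cinner_diff_right: "cinner z (x - y) = cinner z x - cinner z (y :: 'a :: complex_inner)"
  using cinner_add_right[of z "x - y" y] by simp

lemma cinner_minus_right: "cinner x (- y) = - cinner x (y :: 'a :: complex_inner)"
  using cinner_diff_right[of x 0 y] by simp

lemma cinner_scaleR_left: "cinner (r *\<^sub>R x) y = complex_of_real r * cinner x (y :: 'a :: complex_inner)"
  by (simp add: scaleR_scaleC cinner_scaleC_left)

lemma cinner_scaleR_right: "cinner x (r *\<^sub>R y) = complex_of_real r * cinner x (y :: 'a :: complex_inner)"
  by (simp add: scaleR_scaleC cinner_scaleC_right)

lemma Re_cinner_self: "Re (cinner x x) = (norm (x :: 'a :: complex_inner))\<^sup>2"
  by (simp add: cinner_self del: of_real_power)

lemma Re_cinner_commute: "Re (cinner x y) = Re (cinner y (x :: 'a :: complex_inner))"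
  by (metis cinner_commute complex_cnj(1) complex_surj complex.sel(1))

lemma norm_add_sq:
  "(norm (x + y))\<^sup>2 = (norm x)\<^sup>2 + 2 * Re (cinner x y) + (norm (y :: 'a :: complex_inner))\<^sup>2"
  unfolding Re_cinner_self[symmetric] using Re_cinner_commute[of x y]
  by (simp add: cinner_add_left cinner_add_right)

lemma norm_diff_sq:
  "(norm (x - y))\<^sup>2 = (norm x)\<^sup>2 - 2 * Re (cinner x y) + (norm (y :: 'a :: complex_inner))\<^sup>2"
  using norm_add_sq[of x "- y"] by (simp add: cinner_minus_right)

text \<open>The triangle inequality is part of the normed-space structure, so squaring it and
  expanding \<open>norm (x + y)\<close> leaves exactly this half of Cauchy-Schwarz.\<close>

lemma Re_cinner_le_norm: "Re (cinner x y) \<le> norm x * norm (y :: 'a :: complex_inner)"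
proof -
  have "(norm (x + y))\<^sup>2 \<le> (norm x + norm y)\<^sup>2"
    by (intro power_mono norm_triangle_ineq) simp
  then show ?thesis
    by (simp add: norm_add_sq power2_sum)
qed

text \<open>Multiplying \<open>x\<close> by a unimodular \<open>u\<close> turns the inner product
  into a nonnegative real number without changing \<open>norm x\<close>, so the bound on real parts
  suffices.\<close>

lemma cmod_cinner_le_norm: "cmod (cinner x y) \<le> norm x * norm (y :: 'a :: complex_inner)"
proof (cases "cinner x y = 0")
  case False
  define u where "u = cnj (cinner x y) / cmod (cinner x y)"
  have "cmod u = 1" and "u * cinner x y = cmod (cinner x y)"
    using False
    by (simp_all add: u_def norm_divide field_simps complex_norm_square[symmetric] power2_eq_square)
  then show ?thesis
    using Re_cinner_le_norm[of "u *\<^sub>C x" y] by (simp add: cinner_scaleC_left norm_scaleC)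
qed simp

lemma cinner_ext:
  fixes x y :: "'a :: complex_inner"
  assumes "\<And>z. cinner x z = cinner y z"
  shows "x = y"
  using Re_cinner_self[of "x - y"] assms[of "x - y"] by (simp add: cinner_diff_left)

section \<open>Operator algebra\<close>

lemma cblinfun_eqI: "(\<And>x. S x = T x) \<Longrightarrow> S = T" for S T :: "'a :: complex_inner \<Rightarrow>\<^sub>C\<^sub>L 'b :: complex_inner"
  by (metis cblinfun_apply_inject ext)

lemma bounded_clinear_cblinfun_apply:
  "bounded_clinear (cblinfun_apply (T :: 'a :: complex_inner \<Rightarrow>\<^sub>C\<^sub>L 'b :: complex_inner))"
  using cblinfun_apply[of T] by simp

lemma bounded_linear_cblinfun_apply:
  "bounded_linear (cblinfun_apply (T :: 'a :: complex_inner \<Rightarrow>\<^sub>C\<^sub>L 'b :: complex_inner))"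
  using bounded_clinear_cblinfun_apply[of T] by (simp add: bounded_clinear_def)

context
  fixes T :: "'a :: complex_inner \<Rightarrow>\<^sub>C\<^sub>L 'b :: complex_inner"
begin

lemma cblinfun_apply_add: "T (x + y) = T x + T y"
  by (rule linear_add[OF bounded_linear.linear[OF bounded_linear_cblinfun_apply]])

lemma cblinfun_apply_diff: "T (x - y) = T x - T y"
  by (rule linear_diff[OF bounded_linear.linear[OF bounded_linear_cblinfun_apply]])

lemma cblinfun_apply_minus: "T (- x) = - T x"
  by (rule linear_neg[OF bounded_linear.linear[OF bounded_linear_cblinfun_apply]])

lemma cblinfun_apply_zero: "T 0 = 0"
  by (rule linear_0[OF bounded_linear.linear[OF bounded_linear_cblinfun_apply]])

lemma cblinfun_apply_scaleC: "T (c *\<^sub>C x) = c *\<^sub>C T x"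
  using bounded_clinear_cblinfun_apply[of T] by (simp add: bounded_clinear_def)

lemma cblinfun_apply_scaleR: "T (r *\<^sub>R x) = r *\<^sub>R T x"
  by (simp add: scaleR_scaleC cblinfun_apply_scaleC)

lemma norm_cblinfun_apply_le: "norm (T x) \<le> norm T * norm x"
  unfolding norm_cblinfun.rep_eq by (rule onorm[OF bounded_linear_cblinfun_apply])

lemma norm_cblinfun_le: "0 \<le> b \<Longrightarrow> (\<And>x. norm (T x) \<le> b * norm x) \<Longrightarrow> norm T \<le> b"
  unfolding norm_cblinfun.rep_eq by (rule onorm_bound)

end

lemmas cblinfun_linear_simps [simp] =
  cblinfun_apply_add cblinfun_apply_diff cblinfun_apply_minus cblinfun_apply_zero
  cblinfun_apply_scaleC cblinfun_apply_scaleR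
  cblinfun_compose.rep_eq id_cblinfun.rep_eq plus_cblinfun.rep_eq minus_cblinfun.rep_eq
  uminus_cblinfun.rep_eq zero_cblinfun.rep_eq scaleC_cblinfun.rep_eq scaleR_cblinfun.rep_eq

lemma norm_cblinfun_compose_le:
  "norm (S o\<^sub>C T) \<le> norm (S :: 'b :: complex_inner \<Rightarrow>\<^sub>C\<^sub>L 'c :: complex_inner) *
    norm (T :: 'a :: complex_inner \<Rightarrow>\<^sub>C\<^sub>L 'b)"
proof (rule norm_cblinfun_le)
  fix x
  have "norm ((S o\<^sub>C T) x) \<le> norm S * norm (T x)"
    by (simp add: norm_cblinfun_apply_le)
  also have "\<dots> \<le> norm S * (norm T * norm x)"
    by (intro mult_left_mono norm_cblinfun_apply_le) simp
  finally show "norm ((S o\<^sub>C T) x) \<le> norm S * norm T * norm x"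
    by (simp add: mult.assoc)
qed simp

text \<open>Completeness of the operator space is what permits the Banach fixed point argument for
  square roots. The limit is built pointwise; the estimate \<open>bd\<close>, uniform in
  \<open>x\<close> up to the factor \<open>norm x\<close>, then gives convergence in operator
  norm.\<close>

instance cblinfun :: (complex_inner, chilbert_space) complete_space
proof
  fix X :: "nat \<Rightarrow> 'a \<Rightarrow>\<^sub>C\<^sub>L 'b"
  assume X: "Cauchy X"
  have bd: "\<exists>M. \<forall>m\<ge>M. \<forall>n\<ge>M. \<forall>x. norm (X m x - X n x) \<le> e * norm x" if "0 < e" for e
  proof -
    obtain M where "\<forall>m\<ge>M. \<forall>n\<ge>M. norm (X m - X n) < e"
      using X \<open>0 < e\<close> by (metis metric_CauchyD dist_norm)
    moreover have "norm (X m x - X n x) \<le> norm (X m - X n) * norm x" for m n x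
      using norm_cblinfun_apply_le[of "X m - X n" x] by simp
    ultimately show ?thesis
      by (meson less_imp_le mult_right_mono norm_ge_zero order_trans)
  qed
  have "Cauchy (\<lambda>k. X k x)" for x
  proof (rule metric_CauchyI)
    fix e :: real assume e: "0 < e"
    \<comment> \<open>The summand 1 keeps the denominator positive at \<open>x = 0\<close> and makes
      \<open>d * norm x < e\<close> strict.\<close>
    define d where "d = e / (norm x + 1)"
    have d: "0 < d" "d * norm x < e"
      using e by (simp_all add: d_def field_simps add_pos_nonneg)
    obtain M where "\<forall>m\<ge>M. \<forall>n\<ge>M. norm (X m x - X n x) \<le> d * norm x"
      using bd[OF d(1)] by blast
    then show "\<exists>M. \<forall>m\<ge>M. \<forall>n\<ge>M. dist (X m x) (X n x) < e"
      unfolding dist_norm using order_le_less_trans[OF _ d(2)] by blast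
  qed
  then have "\<exists>l. (\<lambda>k. X k x) \<longlonglongrightarrow> l" for x
    by (simp add: Cauchy_convergent_iff convergent_def)
  then obtain l where l: "(\<lambda>k. X k x) \<longlonglongrightarrow> l x" for x
    by metis
  have near: "\<exists>M. \<forall>m\<ge>M. \<forall>x. norm (X m x - l x) \<le> e * norm x" if "0 < e" for e
  proof -
    obtain M where M: "\<forall>m\<ge>M. \<forall>n\<ge>M. \<forall>x. norm (X m x - X n x) \<le> e * norm x"
      using bd[OF \<open>0 < e\<close>] by blast
    have "norm (X m x - l x) \<le> e * norm x" if "m \<ge> M" for m x
    proof (rule LIMSEQ_le_const2)
      show "(\<lambda>n. norm (X m x - X n x)) \<longlonglongrightarrow> norm (X m x - l x)"
        by (intro tendsto_intros l)
    qed (use M that in blast)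
    then show ?thesis by blast
  qed
  have "l (x + y) = l x + l y" for x y
    by (rule LIMSEQ_unique[OF l]) (use tendsto_add[OF l l] in simp)
  moreover have lC: "l (c *\<^sub>C x) = c *\<^sub>C l x" for c x
    by (rule LIMSEQ_unique[OF l])
      (use bounded_linear.tendsto[OF _ l] bounded_clinear_scaleC in \<open>auto simp: bounded_clinear_def\<close>)
  moreover have "\<exists>K. \<forall>x. norm (l x) \<le> norm x * K"
  proof -
    obtain M where M: "\<forall>x. norm (X M x - l x) \<le> norm x"
      using near[of 1] by auto
    have "norm (l x) \<le> norm x * (1 + norm (X M))" for x
      using M[rule_format, of x] norm_cblinfun_apply_le[of "X M" x]
        norm_triangle_ineq4[of "X M x" "X M x - l x"] by (simp add: algebra_simps)
    then show ?thesis by blast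
  qed
  ultimately have "bounded_clinear l"
    unfolding bounded_clinear_def by (auto intro!: bounded_linear_intro simp: scaleR_scaleC)
  then obtain L where L: "\<And>x. cblinfun_apply L x = l x"
    by (metis Abs_cblinfun_inverse mem_Collect_eq)
  have "X \<longlonglongrightarrow> L"
  proof (rule metric_LIMSEQ_I)
    fix e :: real assume "0 < e"
    then obtain M where M: "\<forall>m\<ge>M. \<forall>x. norm (X m x - l x) \<le> e / 2 * norm x"
      using near[of "e / 2"] by auto
    have "dist (X m) L < e" if "m \<ge> M" for m
    proof -
      have "norm (X m - L) \<le> e / 2"
        using \<open>0 < e\<close> M that by (intro norm_cblinfun_le) (auto simp: L)
      then show ?thesis
        using \<open>0 < e\<close> by (simp add: dist_norm)
    qed
    then show "\<exists>M. \<forall>m\<ge>M. dist (X m) L < e" by blast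
  qed
  then show "convergent X"
    by (rule convergentI)
qed

section \<open>Adjoints\<close>

text \<open>The representing vector minimizes \<open>J x = (norm x)\<^sup>2 - 2 Re (f x)\<close>.\<close>

theorem Riesz_representation:
  fixes f :: "'a :: chilbert_space \<Rightarrow> complex"
  assumes add: "\<And>x y. f (x + y) = f x + f y"
    and scale: "\<And>c x. f (c *\<^sub>C x) = c * f x"
    and bound: "\<And>x. cmod (f x) \<le> K * norm x"
  shows "\<exists>u. \<forall>x. f x = cinner x u"
proof -
  define J where "J x = (norm x)\<^sup>2 - 2 * Re (f x)" for x
  have Jlow: "- K\<^sup>2 \<le> J x" for x
  proof -
    have "Re (f x) \<le> K * norm x"
      using bound[of x] complex_Re_le_cmod[of "f x"] by linarith
    moreover have "0 \<le> (norm x - K)\<^sup>2" by simp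
    ultimately show ?thesis
      by (simp add: J_def power2_diff algebra_simps)
  qed
  define m where "m = (INF x. J x)"
  have bdd: "bdd_below (range J)"
    using Jlow unfolding bdd_below_def by blast
  have mle: "m \<le> J x" for x
    unfolding m_def by (rule cINF_lower[OF bdd]) simp
  have "\<exists>x. J x < m + 1 / Suc n" for n
    using cINF_less_iff[OF _ bdd, of "m + 1 / Suc n"] by (auto simp: m_def)
  then obtain X where X: "J (X n) < m + 1 / Suc n" for n
    by metis
  \<comment> \<open>Parallelogram law: \<open>J\<close> is at least \<open>m\<close> at the midpoint
    of \<open>x\<close> and \<open>y\<close>, so two near-minimizers must be close. This makes every
    minimizing sequence Cauchy.\<close>
  have mid: "(norm (x - y))\<^sup>2 \<le> 2 * (J x + J y - 2 * m)" for x y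
  proof -
    have f2: "f ((1/2) *\<^sub>R (x + y)) = (f x + f y) / 2"
      using scale[of "1/2" "x + y"] by (simp add: add scaleR_scaleC)
    have n2: "(norm ((1/2) *\<^sub>R (x + y)))\<^sup>2 = (norm (x + y))\<^sup>2 / 4"
      by (simp add: power_divide)
    have "m \<le> J ((1/2) *\<^sub>R (x + y))" by (rule mle)
    then have "m \<le> (norm (x + y))\<^sup>2 / 4 - Re (f x + f y)"
      unfolding J_def f2 n2 by (simp add: add_divide_distrib)
    then show ?thesis
      unfolding J_def norm_add_sq norm_diff_sq by (simp add: field_simps)
  qed
  have close: "norm (X i - X j) < e" if "0 < e" "4 / Suc M < e\<^sup>2" "i \<ge> M" "j \<ge> M" for e M i j
  proof -
    have "J (X k) < m + 1 / Suc M" if "k \<ge> M" for k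
      using X[of k] that by (smt (verit) Suc_le_mono frac_le of_nat_0_less_iff of_nat_mono zero_less_Suc)
    then have "(norm (X i - X j))\<^sup>2 < 4 / Suc M"
      using mid[of "X i" "X j"] that(3,4) by (smt (verit) add_divide_distrib)
    then show ?thesis
      using that(1,2) by (meson less_imp_le order_less_trans power_less_imp_less_base)
  qed
  have "Cauchy X"
  proof (rule metric_CauchyI)
    fix e :: real assume e: "0 < e"
    then obtain M where "inverse (Suc M) < e\<^sup>2 / 4"
      using reals_Archimedean[of "e\<^sup>2 / 4"] by auto
    then have "4 / Suc M < e\<^sup>2"
      by (simp add: field_simps)
    then show "\<exists>M. \<forall>i\<ge>M. \<forall>j\<ge>M. dist (X i) (X j) < e"
      using close[OF e] by (auto simp: dist_norm)
  qed
  then obtain u where u: "X \<longlonglongrightarrow> u"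
    using Cauchy_convergent convergent_def by blast
  have fdiff: "f (x - y) = f x - f y" for x y
    using add[of "x - y" y] by simp
  have "(\<lambda>n. f (X n)) \<longlonglongrightarrow> f u"
  proof (rule LIM_zero_cancel, rule Lim_null_comparison)
    show "\<forall>\<^sub>F n in sequentially. norm (f (X n) - f u) \<le> K * norm (X n - u)"
      using bound[of "X n - u" for n] by (simp add: fdiff)
    show "(\<lambda>n. K * norm (X n - u)) \<longlonglongrightarrow> 0"
      using u by (intro tendsto_mult_right_zero) (simp add: tendsto_norm_zero LIM_zero)
  qed
  then have "(\<lambda>n. J (X n)) \<longlonglongrightarrow> J u"
    unfolding J_def by (intro tendsto_intros u)
  moreover have "(\<lambda>n. J (X n)) \<longlonglongrightarrow> m"
  proof (rule tendsto_sandwich[where f = "\<lambda>_. m"])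
    show "(\<lambda>n. m + 1 / Suc n) \<longlonglongrightarrow> m"
      using tendsto_add[OF tendsto_const LIMSEQ_inverse_real_of_nat, of m] by (simp add: inverse_eq_divide)
    show "\<forall>\<^sub>F n in sequentially. J (X n) \<le> m + 1 / Suc n"
      using X by (simp add: less_imp_le)
  qed (auto simp: mle)
  ultimately have Ju: "J u = m"
    by (rule LIMSEQ_unique)
  have Re_eq: "Re (cinner h u) = Re (f h)" for h
  proof -
    define d where "d = Re (cinner h u) - Re (f h)"
    \<comment> \<open>The right-hand side is \<open>J (u + t *\<^sub>R h) - J u\<close>, a quadratic
      in \<open>t\<close> whose linear coefficient must vanish at a minimizer.\<close>
    have key: "0 \<le> 2 * t * d + t\<^sup>2 * (norm h)\<^sup>2" for t
    proof -
      have "J u \<le> J (u + t *\<^sub>R h)"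
        by (simp add: Ju mle)
      moreover have "f (t *\<^sub>R h) = t * f h"
        by (simp add: scaleR_scaleC scale)
      ultimately show ?thesis
        using Re_cinner_commute[of u h]
        by (simp add: J_def d_def norm_add_sq add cinner_scaleR_right power_mult_distrib algebra_simps)
    qed
    have "d = 0"
    proof (rule ccontr)
      assume "d \<noteq> 0"
      \<comment> \<open>With \<open>t = - d / s\<close> the linear term dominates and the quadratic
        becomes negative; the 1 covers \<open>h = 0\<close>.\<close>
      define s where "s = 1 + (norm h)\<^sup>2"
      have s: "0 < s" by (simp add: s_def add_pos_nonneg)
      have "0 \<le> 2 * (- d / s) * d + (- d / s)\<^sup>2 * (norm h)\<^sup>2" by (rule key)
      also have "\<dots> = (d\<^sup>2 / s) * ((norm h)\<^sup>2 / s - 2)"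
        using s by (simp add: field_simps power2_eq_square)
      also have "\<dots> < 0"
      proof (rule mult_pos_neg)
        show "0 < d\<^sup>2 / s" using s \<open>d \<noteq> 0\<close> by simp
        show "(norm h)\<^sup>2 / s - 2 < 0" using s by (simp add: s_def divide_simps)
      qed
      finally show False by simp
    qed
    then show ?thesis by (simp add: d_def)
  qed
  have "f h = cinner h u" for h
  proof (rule complex_eqI)
    show "Re (f h) = Re (cinner h u)" by (simp add: Re_eq)
    \<comment> \<open>Both sides are complex linear in \<open>h\<close>, so the real parts at
      \<open>\<i> *\<^sub>C h\<close> give the imaginary parts at \<open>h\<close> up to
      sign.\<close>
    show "Im (f h) = Im (cinner h u)"
      using Re_eq[of "\<i> *\<^sub>C h"] by (simp add: scale cinner_scaleC_left)
  qed
  then show ?thesis by blast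
qed

text \<open>For fixed \<open>x\<close> the functional sending \<open>y\<close> to
  \<open>cinner (T y) x\<close> is bounded and linear, and its Riesz vector is the value of the
  adjoint at \<open>x\<close>. Linearity in \<open>x\<close> follows from uniqueness of that
  vector.\<close>

lemma ex_adjoint:
  fixes T :: "'a :: chilbert_space \<Rightarrow>\<^sub>C\<^sub>L 'b :: chilbert_space"
  shows "\<exists>S :: 'b \<Rightarrow>\<^sub>C\<^sub>L 'a. \<forall>x y. cinner (S x) y = cinner x (T y)"
proof -
  have "\<exists>u. \<forall>y. cinner (T y) x = cinner y u" for x
  proof (rule Riesz_representation)
    fix y
    have "cmod (cinner (T y) x) \<le> norm (T y) * norm x"
      by (rule cmod_cinner_le_norm)
    also have "\<dots> \<le> (norm T * norm y) * norm x"
      by (intro mult_right_mono norm_cblinfun_apply_le) simp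
    finally show "cmod (cinner (T y) x) \<le> (norm T * norm x) * norm y"
      by (simp add: mult_ac)
  qed (simp_all add: cinner_add_left cinner_scaleC_left)
  then obtain s where "cinner (T y) x = cinner y (s x)" for x y
    by metis
  then have s: "cinner (s x) y = cinner x (T y)" for x y
    by (metis cinner_commute)
  have "norm (s x) \<le> norm x * norm T" for x
  proof -
    \<comment> \<open>Testing the defining relation at \<open>y = s x\<close> bounds the square of
      the norm by a multiple of the norm itself, which then cancels.\<close>
    have "(norm (s x))\<^sup>2 = Re (cinner x (T (s x)))"
      by (simp add: s[symmetric] Re_cinner_self)
    also have "\<dots> \<le> norm x * (norm T * norm (s x))"
      by (intro order_trans[OF Re_cinner_le_norm] mult_left_mono norm_cblinfun_apply_le) simp
    finally have "norm (s x) * norm (s x) \<le> (norm x * norm T) * norm (s x)"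
      by (simp add: power2_eq_square mult_ac)
    then show ?thesis
      by (cases "s x = 0") (auto intro: mult_right_le_imp_le)
  qed
  moreover have "s (x + y) = s x + s y" for x y
    by (rule cinner_ext) (simp add: s cinner_add_left)
  moreover have "s (c *\<^sub>C x) = c *\<^sub>C s x" for c x
    by (rule cinner_ext) (simp add: s cinner_scaleC_left)
  ultimately have "bounded_clinear s"
    unfolding bounded_clinear_def by (auto intro!: bounded_linear_intro simp: scaleR_scaleC)
  then have "cblinfun_apply (Abs_cblinfun s) = s"
    by (simp add: Abs_cblinfun_inverse)
  then show ?thesis
    by (metis s)
qed

context
  fixes T :: "'a :: chilbert_space \<Rightarrow>\<^sub>C\<^sub>L 'b :: chilbert_space"
begin

lemma cinner_adjoint_left: "cinner (T\<^sup>\<dagger> x) y = cinner x (T y)"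
proof -
  have "\<exists>!S. \<forall>x y. cinner (cblinfun_apply S x) y = cinner x (cblinfun_apply T y)"
    by (rule ex_ex1I[OF ex_adjoint]) (metis cblinfun_eqI cinner_ext)
  from theI'[OF this] show ?thesis
    by (simp add: cadjoint_def)
qed

lemma cinner_adjoint_right: "cinner x (T\<^sup>\<dagger> y) = cinner (T x) y"
  by (metis cinner_adjoint_left cinner_commute)

lemma cinner_apply_adjoint_left: "cinner (T (T\<^sup>\<dagger> x)) y = cinner (T\<^sup>\<dagger> x) (T\<^sup>\<dagger> y)"
  by (simp add: cinner_adjoint_right)

lemma cadjoint_eqI: "(\<And>x y. cinner (S x) y = cinner x (T y)) \<Longrightarrow> T\<^sup>\<dagger> = S"
  for S :: "'b \<Rightarrow>\<^sub>C\<^sub>L 'a"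
  by (intro cblinfun_eqI cinner_ext) (simp add: cinner_adjoint_left)

lemma norm_cadjoint_le: "norm (T\<^sup>\<dagger>) \<le> norm T"
proof (rule norm_cblinfun_le)
  fix x
  have "(norm (T\<^sup>\<dagger> x))\<^sup>2 = Re (cinner x (T (T\<^sup>\<dagger> x)))"
    by (simp add: cinner_adjoint_left[symmetric] Re_cinner_self)
  also have "\<dots> \<le> norm x * (norm T * norm (T\<^sup>\<dagger> x))"
    by (intro order_trans[OF Re_cinner_le_norm] mult_left_mono norm_cblinfun_apply_le) simp
  finally have "norm (T\<^sup>\<dagger> x) * norm (T\<^sup>\<dagger> x) \<le> (norm T * norm x) * norm (T\<^sup>\<dagger> x)"
    by (simp add: power2_eq_square mult_ac)
  then show "norm (T\<^sup>\<dagger> x) \<le> norm T * norm x"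
    by (cases "T\<^sup>\<dagger> x = 0") (auto intro: mult_right_le_imp_le)
qed simp

end

lemma cadjoint_cadjoint [simp]: "T\<^sup>\<dagger>\<^sup>\<dagger> = T"
  for T :: "'a :: chilbert_space \<Rightarrow>\<^sub>C\<^sub>L 'b :: chilbert_space"
  by (intro cadjoint_eqI) (simp add: cinner_adjoint_right)

lemma cadjoint_compose: "(S o\<^sub>C T)\<^sup>\<dagger> = T\<^sup>\<dagger> o\<^sub>C S\<^sup>\<dagger>"
  for S :: "'b :: chilbert_space \<Rightarrow>\<^sub>C\<^sub>L 'c :: chilbert_space" and T :: "'a :: chilbert_space \<Rightarrow>\<^sub>C\<^sub>L 'b"
  by (intro cadjoint_eqI) (simp add: cinner_adjoint_left)

section \<open>Invertibility of coercive operators\<close>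

lemma op_inv_eqI:
  fixes T :: "'a :: chilbert_space \<Rightarrow>\<^sub>C\<^sub>L 'b :: chilbert_space" and S :: "'b \<Rightarrow>\<^sub>C\<^sub>L 'a"
  assumes "\<And>x. S (T x) = x" "\<And>y. T (S y) = y"
  shows "op_inv T = S"
  unfolding op_inv_def
proof (rule the_equality)
  show "S o\<^sub>C T = id_cblinfun \<and> T o\<^sub>C S = id_cblinfun"
    using assms by (auto intro!: cblinfun_eqI)
next
  fix R assume "R o\<^sub>C T = id_cblinfun \<and> T o\<^sub>C R = id_cblinfun"
  then have "R (T x) = x" for x
    by (metis cblinfun_compose.rep_eq id_cblinfun.rep_eq)
  then show "R = S"
    by (intro cblinfun_eqI) (metis assms(2))
qed

lemma op_invertibleI:
  fixes T :: "'a :: chilbert_space \<Rightarrow>\<^sub>C\<^sub>L 'b :: chilbert_space" and S :: "'b \<Rightarrow>\<^sub>C\<^sub>L 'a"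
  assumes "\<And>x. S (T x) = x" "\<And>y. T (S y) = y"
  shows "op_invertible T"
  unfolding op_invertible_def
  by (rule exI[of _ S]) (use assms in \<open>auto intro!: cblinfun_eqI\<close>)

lemma
  fixes T :: "'a :: chilbert_space \<Rightarrow>\<^sub>C\<^sub>L 'b :: chilbert_space"
  assumes "op_invertible T"
  shows op_inv_left: "op_inv T (T x) = x" and op_inv_right: "T (op_inv T y) = y"
proof -
  obtain S where "S o\<^sub>C T = id_cblinfun" "T o\<^sub>C S = id_cblinfun"
    using assms by (auto simp: op_invertible_def)
  then have S: "S (T x) = x" "T (S y) = y" for x y
    by (metis cblinfun_compose.rep_eq id_cblinfun.rep_eq)+
  then show "op_inv T (T x) = x" "T (op_inv T y) = y"
    by (simp_all add: op_inv_eqI[OF S])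
qed

text \<open>The inverse of \<open>T\<close> is \<open>op_inv (S o\<^sub>C T) o\<^sub>C S\<close>;
  that it is also a right inverse uses injectivity of \<open>S\<close>. It transfers invertibility
  from \<open>P o\<^sub>C (id_cblinfun - \<zeta> *\<^sub>C Z\<^sup>\<dagger>)\<close> to the second
  factor.\<close>

lemma op_invertible_if_compose:
  fixes S :: "'b :: chilbert_space \<Rightarrow>\<^sub>C\<^sub>L 'c :: chilbert_space"
    and T :: "'a :: chilbert_space \<Rightarrow>\<^sub>C\<^sub>L 'b"
  assumes S: "op_invertible S" and ST: "op_invertible (S o\<^sub>C T)"
  shows "op_invertible T"
proof (rule op_invertibleI)
  fix x y
  show "(op_inv (S o\<^sub>C T) o\<^sub>C S) (T x) = x"
    using op_inv_left[OF ST, of x] by simp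
  show "T ((op_inv (S o\<^sub>C T) o\<^sub>C S) y) = y"
    using op_inv_right[OF ST, of "S y"] op_inv_left[OF S] by (metis cblinfun_compose.rep_eq)
qed

text \<open>Only the real part of the form is bounded below, so operators that are not selfadjoint
  are covered as well.\<close>

definition coercive :: "real \<Rightarrow> ('a :: chilbert_space \<Rightarrow>\<^sub>C\<^sub>L 'a) \<Rightarrow> bool" where
  "coercive e T \<longleftrightarrow> 0 < e \<and> (\<forall>x. e * (norm x)\<^sup>2 \<le> Re (cinner (T x) x))"

text \<open>Expanding the square bounds \<open>(norm (x - t *\<^sub>R T x))\<^sup>2\<close> by
  \<open>(1 - 2 * t * e + t\<^sup>2 * K\<^sup>2) * (norm x)\<^sup>2\<close> whenever
  \<open>norm T \<le> K\<close>; the choice \<open>t = e / K\<^sup>2\<close> minimizes the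
  factor.\<close>

lemma coercive_contraction:
  fixes T :: "'a :: chilbert_space \<Rightarrow>\<^sub>C\<^sub>L 'a"
  assumes "coercive e T"
  obtains t c where "0 < t" "0 \<le> c" "c < 1" "\<And>x. norm (x - t *\<^sub>R T x) \<le> c * norm x"
proof -
  have e: "0 < e" and co: "\<And>x. e * (norm x)\<^sup>2 \<le> Re (cinner (T x) x)"
    using assms by (auto simp: coercive_def)
  \<comment> \<open>Adding \<open>e\<close> ensures \<open>0 < K\<close> and
    \<open>e \<le> K\<close>, so the radicand in \<open>c\<close> lies in [0, 1).\<close>
  define K where "K = norm T + e"
  define t where "t = e / K\<^sup>2"
  define c where "c = sqrt (1 - e\<^sup>2 / K\<^sup>2)"
  have K: "0 < K" "e \<le> K" "norm T \<le> K"
    using e by (simp_all add: K_def add_nonneg_pos)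
  have q: "0 < e\<^sup>2 / K\<^sup>2" "e\<^sup>2 / K\<^sup>2 \<le> 1"
    using e K by (simp_all add: power_mono)
  have "norm (x - t *\<^sub>R T x) \<le> c * norm x" for x
  proof -
    have "norm (T x) \<le> K * norm x"
      using norm_cblinfun_apply_le[of T x] K(3) by (meson mult_right_mono norm_ge_zero order_trans)
    then have "t\<^sup>2 * (norm (T x))\<^sup>2 \<le> t\<^sup>2 * (K * norm x)\<^sup>2"
      by (intro mult_left_mono power_mono) auto
    also have "\<dots> = e\<^sup>2 / K\<^sup>2 * (norm x)\<^sup>2"
      using K by (simp add: t_def field_simps power2_eq_square)
    finally have 1: "t\<^sup>2 * (norm (T x))\<^sup>2 \<le> e\<^sup>2 / K\<^sup>2 * (norm x)\<^sup>2" .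
    have "t * (e * (norm x)\<^sup>2) \<le> t * Re (cinner (T x) x)"
      using e by (intro mult_left_mono co) (simp add: t_def)
    then have 2: "e\<^sup>2 / K\<^sup>2 * (norm x)\<^sup>2 \<le> t * Re (cinner (T x) x)"
      by (simp add: t_def power2_eq_square)
    have "(norm (x - t *\<^sub>R T x))\<^sup>2 =
        (norm x)\<^sup>2 - 2 * (t * Re (cinner (T x) x)) + t\<^sup>2 * (norm (T x))\<^sup>2"
      using Re_cinner_commute[of x "T x"]
      by (simp add: norm_diff_sq cinner_scaleR_right power_mult_distrib)
    also have "\<dots> \<le> (1 - e\<^sup>2 / K\<^sup>2) * (norm x)\<^sup>2"
      using 1 2 by (simp add: algebra_simps)
    also have "\<dots> = (c * norm x)\<^sup>2"
      using q by (simp add: c_def power_mult_distrib)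
    finally show ?thesis
      by (rule power2_le_imp_le) (use q in \<open>simp add: c_def\<close>)
  qed
  moreover have "0 < t" "0 \<le> c" "c < 1"
    using e K q by (simp_all add: t_def c_def)
  ultimately show thesis by (rule that[rotated 3])
qed

lemma coercive_lower_bound:
  fixes T :: "'a :: chilbert_space \<Rightarrow>\<^sub>C\<^sub>L 'a"
  assumes "coercive e T"
  shows "e * norm x \<le> norm (T x)"
proof (cases "x = 0")
  case False
  have "e * norm x * norm x \<le> norm (T x) * norm x"
    using assms Re_cinner_le_norm[of "T x" x]
    by (auto simp: coercive_def power2_eq_square mult.assoc intro: order_trans)
  then show ?thesis
    using False by simp
qed simp

text \<open>Lax-Milgram argument: the equation \<open>T x = y\<close> is the fixed point equation of
  the contraction sending \<open>x\<close> to \<open>x - t *\<^sub>R (T x - y)\<close>. The lower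
  bound \<open>e * norm x \<le> norm (T x)\<close> makes the solution unique and the inverse
  bounded.\<close>

theorem coercive_op_invertible:
  fixes T :: "'a :: chilbert_space \<Rightarrow>\<^sub>C\<^sub>L 'a"
  assumes T: "coercive e T"
  shows "op_invertible T"
proof -
  obtain t c where tc: "0 < t" "0 \<le> c" "c < 1" "\<And>x. norm (x - t *\<^sub>R T x) \<le> c * norm x"
    using coercive_contraction[OF T] by blast
  have e: "0 < e"
    using T by (simp add: coercive_def)
  have "\<exists>x. T x = y" for y
  proof -
    have "\<exists>!x. x \<in> UNIV \<and> x - t *\<^sub>R (T x - y) = x"
    proof (rule Banach_fix)
      show "dist (x - t *\<^sub>R (T x - y)) (x' - t *\<^sub>R (T x' - y)) \<le> c * dist x x'" for x x'
        using tc(4)[of "x - x'"] by (simp add: dist_norm algebra_simps)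
    qed (use tc complete_UNIV in auto)
    then show ?thesis
      using tc(1) by auto
  qed
  then obtain s where s: "T (s y) = y" for y
    by metis
  have inj: "x = x'" if "T x = T x'" for x x'
    using coercive_lower_bound[OF T, of "x - x'"] that e by (simp add: mult_le_0_iff)
  have "norm (s y) \<le> norm y * (1 / e)" for y
    using coercive_lower_bound[OF T, of "s y"] e by (simp add: s field_simps)
  moreover have "s (x + y) = s x + s y" "s (a *\<^sub>C x) = a *\<^sub>C s x" for a x y
    by (rule inj; simp add: s)+
  ultimately have "bounded_clinear s"
    unfolding bounded_clinear_def by (auto intro!: bounded_linear_intro[where K = "1 / e"] simp: scaleR_scaleC)
  then have "cblinfun_apply (Abs_cblinfun s) = s"
    by (simp add: Abs_cblinfun_inverse)
  then show ?thesis
    by (intro op_invertibleI[of "Abs_cblinfun s"]) (auto simp: s inj)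
qed

section \<open>Positive operators\<close>

lemma positive_op_nonneg: "positive_op T \<Longrightarrow> 0 \<le> Re (cinner (T x) x)"
  by (simp add: positive_op_def complex_nonneg_Reals_iff)

text \<open>Polarization: the imaginary parts of the quadratic form vanish at \<open>x + y\<close> and at
  \<open>x + \<i> y\<close>.\<close>

lemma positive_op_selfadjoint:
  fixes T :: "'a :: chilbert_space \<Rightarrow>\<^sub>C\<^sub>L 'a"
  assumes "positive_op T"
  shows "T\<^sup>\<dagger> = T"
proof (rule cadjoint_eqI)
  fix x y
  have im: "Im (cinner (T z) z) = 0" for z
    using assms by (simp add: positive_op_def complex_nonneg_Reals_iff)
  have "Re (cinner (T x) y) = Re (cinner (T y) x)" "Im (cinner (T x) y) = - Im (cinner (T y) x)"
    using im[of "x + y"] im[of "x + \<i> *\<^sub>C y"]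
    by (simp_all add: im cinner_add_left cinner_add_right cinner_scaleC_left cinner_scaleC_right)
  then show "cinner (T x) y = cinner x (T y)"
    by (subst cinner_commute[of x]) (simp add: complex_eq_iff)
qed

text \<open>Selfadjointness makes the quadratic form equal to its own conjugate, hence real.\<close>

lemma positive_opI:
  fixes T :: "'a :: chilbert_space \<Rightarrow>\<^sub>C\<^sub>L 'a"
  assumes "T\<^sup>\<dagger> = T" "\<And>x. 0 \<le> Re (cinner (T x) x)"
  shows "positive_op T"
proof -
  have "cinner (T x) x = cnj (cinner (T x) x)" for x
    using cinner_adjoint_left[of T x x] cinner_commute[of x "T x"] assms(1) by simp
  then have "Im (cinner (T x) x) = 0" for x
    by (metis cnj.sel(2) equal_neg_zero)
  then show ?thesis
    using assms(2) by (simp add: positive_op_def complex_nonneg_Reals_iff)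
qed

lemma strictly_positiveI: "positive_op T \<Longrightarrow> coercive e T \<Longrightarrow> strictly_positive T"
  by (simp add: strictly_positive_def coercive_op_invertible)

text \<open>Positivity of the form at \<open>x - s T x\<close> with \<open>s = 1 / (norm T + 1)\<close> gives
  \<open>s (norm (T x))\<^sup>2 \<le> Re (cinner (T x) x)\<close>.\<close>

lemma strictly_positive_coercive:
  fixes T :: "'a :: chilbert_space \<Rightarrow>\<^sub>C\<^sub>L 'a"
  assumes "strictly_positive T"
  obtains e where "coercive e T"
proof -
  have pos: "positive_op T" and inv: "op_invertible T"
    using assms by (auto simp: strictly_positive_def)
  define s where "s = 1 / (norm T + 1)"
  have s: "0 < s" "s * norm T \<le> 1"
    by (simp_all add: s_def add_nonneg_pos divide_simps)
  \<comment> \<open>The summand 1 allows division by \<open>M\<close> even on the zero space, where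
    the inverse has norm 0.\<close>
  define M where "M = norm (op_inv T) + 1"
  have M: "0 < M"
    by (simp add: M_def add_nonneg_pos)
  have "s / M\<^sup>2 * (norm x)\<^sup>2 \<le> Re (cinner (T x) x)" for x
  proof -
    have "norm x = norm (op_inv T (T x))"
      by (simp add: op_inv_left[OF inv])
    also have "\<dots> \<le> norm (op_inv T) * norm (T x)"
      by (rule norm_cblinfun_apply_le)
    also have "\<dots> \<le> M * norm (T x)"
      by (intro mult_right_mono) (simp_all add: M_def)
    finally have "(norm x)\<^sup>2 \<le> (M * norm (T x))\<^sup>2"
      by (intro power_mono) auto
    then have 1: "s / M\<^sup>2 * (norm x)\<^sup>2 \<le> s * (norm (T x))\<^sup>2"
      using s M by (simp add: power_mult_distrib field_simps)
    have "Re (cinner (T (T x)) (T x)) \<le> norm (T (T x)) * norm (T x)"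
      by (rule Re_cinner_le_norm)
    also have "\<dots> \<le> norm T * norm (T x) * norm (T x)"
      by (intro mult_right_mono norm_cblinfun_apply_le) simp
    finally have "s * s * Re (cinner (T (T x)) (T x)) \<le> s * s * (norm T * (norm (T x))\<^sup>2)"
      using s by (intro mult_left_mono) (simp_all add: power2_eq_square mult.assoc)
    also have "\<dots> = (s * norm T) * (s * (norm (T x))\<^sup>2)"
      by simp
    also have "\<dots> \<le> 1 * (s * (norm (T x))\<^sup>2)"
      using s by (intro mult_right_mono) simp_all
    finally have 2: "s * s * Re (cinner (T (T x)) (T x)) \<le> s * (norm (T x))\<^sup>2"
      by simp
    have "Re (cinner (T (T x)) x) = (norm (T x))\<^sup>2"
      using cinner_adjoint_left[of T "T x" x] positive_op_selfadjoint[OF pos] by (simp add: Re_cinner_self)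
    then have "Re (cinner (T (x - s *\<^sub>R T x)) (x - s *\<^sub>R T x)) =
        Re (cinner (T x) x) - 2 * (s * (norm (T x))\<^sup>2) + s * s * Re (cinner (T (T x)) (T x))"
      by (simp add: cinner_diff_left cinner_diff_right cinner_scaleR_left cinner_scaleR_right
          Re_cinner_self algebra_simps)
    then show ?thesis
      using positive_op_nonneg[OF pos, of "x - s *\<^sub>R T x"] 1 2 by linarith
  qed
  then have "coercive (s / M\<^sup>2) T"
    using s M by (simp add: coercive_def)
  then show thesis by (rule that)
qed

text \<open>The form of the inverse at \<open>x\<close> equals the form of \<open>T\<close> at
  \<open>op_inv T x\<close>.\<close>

lemma strictly_positive_op_inv:
  fixes T :: "'a :: chilbert_space \<Rightarrow>\<^sub>C\<^sub>L 'a"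
  assumes "strictly_positive T"
  shows "strictly_positive (op_inv T)"
proof -
  have pos: "positive_op T" and inv: "op_invertible T"
    using assms by (auto simp: strictly_positive_def)
  have "cinner (op_inv T x) x = cinner (T (op_inv T x)) (op_inv T x)" for x
    using cinner_adjoint_left[of T "op_inv T x" "op_inv T x"] positive_op_selfadjoint[OF pos]
    by (simp add: op_inv_right[OF inv])
  then have "positive_op (op_inv T)"
    using pos by (simp add: positive_op_def)
  moreover have "op_invertible (op_inv T)"
    by (rule op_invertibleI[of T]) (simp_all add: op_inv_left[OF inv] op_inv_right[OF inv])
  ultimately show ?thesis
    by (simp add: strictly_positive_def)
qed

lemma positive_op_conj:
  fixes T :: "'a :: chilbert_space \<Rightarrow>\<^sub>C\<^sub>L 'a" and C :: "'a \<Rightarrow>\<^sub>C\<^sub>L 'b :: chilbert_space"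
  assumes "positive_op T"
  shows "positive_op (C o\<^sub>C T o\<^sub>C C\<^sup>\<dagger>)"
proof -
  have "cinner (C (T (C\<^sup>\<dagger> x))) x = cinner (T (C\<^sup>\<dagger> x)) (C\<^sup>\<dagger> x)" for x
    by (simp add: cinner_adjoint_right)
  then show ?thesis
    using assms by (simp add: positive_op_def)
qed

lemma strictly_positive_id_plus:
  fixes T :: "'a :: chilbert_space \<Rightarrow>\<^sub>C\<^sub>L 'a"
  assumes "positive_op T"
  shows "strictly_positive (id_cblinfun + T)"
proof (rule strictly_positiveI)
  show "positive_op (id_cblinfun + T)"
    using assms
    by (simp add: positive_op_def complex_nonneg_Reals_iff cinner_add_left cinner_self)
  show "coercive 1 (id_cblinfun + T)"
    using positive_op_nonneg[OF assms] by (simp add: coercive_def cinner_add_left Re_cinner_self)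
qed

section \<open>Square roots\<close>

text \<open>After scaling, \<open>T = I - X\<close> with \<open>norm X \<le> c < 1\<close>, and \<open>I - Y\<close> is a square root of \<open>T\<close> exactly if
  \<open>Y = (X + Y\<^sup>2) / 2\<close>. The right-hand side is a contraction of the ball of radius
  \<open>\<rho> = 1 - sqrt (1 - c)\<close>, which solves \<open>\<rho> = (c + \<rho>\<^sup>2) / 2\<close>.\<close>

lemma ex_sqrt:
  fixes T :: "'a :: chilbert_space \<Rightarrow>\<^sub>C\<^sub>L 'a"
  assumes "strictly_positive T"
  shows "\<exists>S. positive_op S \<and> S o\<^sub>C S = T"
proof -
  obtain e where e: "coercive e T"
    using assms by (rule strictly_positive_coercive)
  obtain t c where tc: "0 < t" "0 \<le> c" "c < 1" "\<And>x. norm (x - t *\<^sub>R T x) \<le> c * norm x"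
    using coercive_contraction[OF e] by blast
  define X where "X = id_cblinfun - t *\<^sub>R T"
  have X: "norm X \<le> c"
    by (rule norm_cblinfun_le) (simp_all add: X_def tc)
  define \<rho> where "\<rho> = 1 - sqrt (1 - c)"
  have \<rho>: "0 \<le> \<rho>" "\<rho> < 1" "c + \<rho> * \<rho> = 2 * \<rho>"
    using tc by (simp_all add: \<rho>_def algebra_simps)
  define \<Phi> where "\<Phi> Y = (1/2) *\<^sub>R (X + Y o\<^sub>C Y)" for Y
  have "\<exists>!Y. Y \<in> cball 0 \<rho> \<and> \<Phi> Y = Y"
  proof (rule Banach_fix)
    show "complete (cball (0 :: 'a \<Rightarrow>\<^sub>C\<^sub>L 'a) \<rho>)"
      by (simp add: complete_eq_closed)
    show "\<Phi> ` cball 0 \<rho> \<subseteq> cball 0 \<rho>"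
    proof clarify
      fix Y :: "'a \<Rightarrow>\<^sub>C\<^sub>L 'a" assume "Y \<in> cball 0 \<rho>"
      then have Y: "norm Y \<le> \<rho>" by simp
      have "norm (X + Y o\<^sub>C Y) \<le> c + \<rho> * \<rho>"
        by (intro order_trans[OF norm_triangle_ineq] add_mono X
            order_trans[OF norm_cblinfun_compose_le] mult_mono Y \<rho>(1)) simp
      then have "norm (\<Phi> Y) \<le> \<rho>"
        using \<rho>(3) by (simp add: \<Phi>_def)
      then show "\<Phi> Y \<in> cball 0 \<rho>" by simp
    qed
    show "dist (\<Phi> Y) (\<Phi> Y') \<le> \<rho> * dist Y Y'" if "Y \<in> cball 0 \<rho>" "Y' \<in> cball 0 \<rho>" for Y Y'
    proof -
      have Y: "norm Y \<le> \<rho>" "norm Y' \<le> \<rho>"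
        using that by simp_all
      \<comment> \<open>The difference of squares is split without assuming that \<open>Y\<close>
        and \<open>Y'\<close> commute; each half contributes \<rho> / 2 to the Lipschitz
        constant.\<close>
      have "\<Phi> Y - \<Phi> Y' = (1/2) *\<^sub>R (Y o\<^sub>C (Y - Y') + (Y - Y') o\<^sub>C Y')"
        by (rule cblinfun_eqI) (simp add: \<Phi>_def algebra_simps)
      then have "dist (\<Phi> Y) (\<Phi> Y') = norm (Y o\<^sub>C (Y - Y') + (Y - Y') o\<^sub>C Y') / 2"
        by (simp add: dist_norm)
      also have "norm (Y o\<^sub>C (Y - Y') + (Y - Y') o\<^sub>C Y') \<le> \<rho> * norm (Y - Y') + norm (Y - Y') * \<rho>"
        by (intro order_trans[OF norm_triangle_ineq] add_mono
            order_trans[OF norm_cblinfun_compose_le] mult_mono Y \<rho>(1)) simp_all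
      finally show ?thesis
        by (simp add: dist_norm)
    qed
  qed (use \<rho> in auto)
  then obtain Y where Y: "norm Y \<le> \<rho>" "\<Phi> Y = Y"
    and uniq: "\<And>Y'. norm Y' \<le> \<rho> \<Longrightarrow> \<Phi> Y' = Y' \<Longrightarrow> Y' = Y"
    unfolding mem_cball_0 by blast
  have T: "T\<^sup>\<dagger> = T"
    using assms by (simp add: strictly_positive_def positive_op_selfadjoint)
  have adj: "\<Phi> (Y\<^sup>\<dagger>) = (\<Phi> Y)\<^sup>\<dagger>"
  proof (rule sym, rule cadjoint_eqI)
    fix x y
    have "cinner (T x) y = cinner x (T y)"
      using cinner_adjoint_left[of T x y] T by simp
    then show "cinner (\<Phi> (Y\<^sup>\<dagger>) x) y = cinner x (\<Phi> Y y)"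
      by (simp add: \<Phi>_def X_def cinner_adjoint_left cinner_add_left cinner_add_right
          cinner_diff_left cinner_diff_right cinner_scaleR_left cinner_scaleR_right)
  qed
  \<comment> \<open>The adjoint of the fixed point is a fixed point in the same ball, because
    \<open>X\<close> is selfadjoint; uniqueness identifies the two.\<close>
  have sa: "Y\<^sup>\<dagger> = Y"
    by (rule uniq) (use norm_cadjoint_le[of Y] Y adj in auto)
  have YY: "Y (Y x) = 2 *\<^sub>R Y x - (x - t *\<^sub>R T x)" for x
  proof -
    have "2 *\<^sub>R Y x = 2 *\<^sub>R \<Phi> Y x"
      by (simp only: Y(2))
    then show ?thesis
      by (simp add: \<Phi>_def X_def)
  qed
  \<comment> \<open>The fixed point equation says that the square of \<open>id_cblinfun - Y\<close>
    is \<open>t *\<^sub>R T\<close>; the factor undoes the scaling.\<close>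
  define S where "S = (1 / sqrt t) *\<^sub>R (id_cblinfun - Y)"
  have "S o\<^sub>C S = T"
  proof (rule cblinfun_eqI)
    fix x
    have "(S o\<^sub>C S) x = (1 / t) *\<^sub>R (x - 2 *\<^sub>R Y x + Y (Y x))"
      using tc(1) by (simp add: S_def algebra_simps scaleR_2)
    then show "(S o\<^sub>C S) x = T x"
      using tc(1) by (simp add: YY)
  qed
  moreover have "positive_op S"
  proof (rule positive_opI)
    show "S\<^sup>\<dagger> = S"
    proof (rule cadjoint_eqI)
      fix x y
      have "cinner (Y x) y = cinner x (Y y)"
        using cinner_adjoint_left[of Y x y] sa by simp
      then show "cinner (S x) y = cinner x (S y)"
        by (simp add: S_def cinner_scaleR_left cinner_scaleR_right cinner_diff_left cinner_diff_right)
    qed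
    fix x
    have "Re (cinner (Y x) x) \<le> norm (Y x) * norm x"
      by (rule Re_cinner_le_norm)
    also have "\<dots> \<le> (1 * norm x) * norm x"
      using Y(1) \<rho>(2)
      by (intro mult_right_mono order_trans[OF norm_cblinfun_apply_le]) simp_all
    finally show "0 \<le> Re (cinner (S x) x)"
      using tc(1)
      by (simp add: S_def cinner_scaleR_left cinner_diff_left Re_cinner_self power2_eq_square)
  qed
  ultimately show ?thesis by blast
qed

text \<open>\<open>S\<close> commutes with its square \<open>T\<close>, hence with
  \<open>op_inv T\<close>, so \<open>op_inv T o\<^sub>C S\<close> inverts \<open>S\<close> on both
  sides.\<close>

lemma strictly_positive_if_square:
  fixes T :: "'a :: chilbert_space \<Rightarrow>\<^sub>C\<^sub>L 'a"
  assumes T: "strictly_positive T" and S: "positive_op S" "S o\<^sub>C S = T"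
  shows "strictly_positive S"
proof -
  have inv: "op_invertible T"
    using T by (simp add: strictly_positive_def)
  have SS: "S (S x) = T x" for x
    using S(2) by (metis cblinfun_compose.rep_eq)
  have comm: "op_inv T (S (T x)) = S x" for x
    by (metis SS op_inv_left[OF inv])
  have "op_invertible S"
  proof (rule op_invertibleI)
    fix x
    show "(op_inv T o\<^sub>C S) (S x) = x"
      by (simp add: SS op_inv_left[OF inv])
    have "op_inv T (S x) = S (op_inv T x)"
      using comm[of "op_inv T x"] by (simp add: op_inv_right[OF inv])
    then show "S ((op_inv T o\<^sub>C S) x) = x"
      by (simp add: SS op_inv_right[OF inv])
  qed
  then show ?thesis
    using S(1) by (simp add: strictly_positive_def)
qed

text \<open>The difference \<open>D = S - R\<close> satisfies \<open>S D + D R = 0\<close>, hence \<open>(I - t S) D = D (I + t R)\<close>, where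
  for small \<open>t\<close> the left factor is a strict contraction and the right one is expanding and
  surjective.\<close>

lemma sqrt_unique:
  fixes T :: "'a :: chilbert_space \<Rightarrow>\<^sub>C\<^sub>L 'a"
  assumes T: "strictly_positive T"
    and S: "positive_op S" "S o\<^sub>C S = T" and R: "positive_op R" "R o\<^sub>C R = T"
  shows "S = R"
proof -
  obtain e where e: "coercive e S"
    using strictly_positive_if_square[OF T S] by (rule strictly_positive_coercive)
  obtain t c where tc: "0 < t" "0 \<le> c" "c < 1" "\<And>x. norm (x - t *\<^sub>R S x) \<le> c * norm x"
    using coercive_contraction[OF e] by blast
  define D where "D = S - R"
  define E where "E = id_cblinfun + t *\<^sub>R R"
  have SS: "S (S x) = R (R x)" for x
    using S(2) R(2) by (metis cblinfun_compose.rep_eq)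
  have DE: "D (E x) = D x - t *\<^sub>R S (D x)" for x
    by (simp add: D_def E_def SS algebra_simps)
  have coE: "coercive 1 E"
    using positive_op_nonneg[OF R(1)] tc(1)
    by (simp add: coercive_def E_def cinner_add_left cinner_scaleR_left Re_cinner_self)
  have "norm (D y) \<le> c * norm D * norm y" for y
  proof -
    obtain x where x: "y = E x"
      using op_inv_right[OF coercive_op_invertible[OF coE]] by metis
    have "norm (D y) \<le> c * norm (D x)"
      unfolding x DE by (rule tc(4))
    also have "\<dots> \<le> c * (norm D * norm x)"
      by (intro mult_left_mono norm_cblinfun_apply_le tc(2))
    also have "\<dots> \<le> c * (norm D * norm y)"
      using coercive_lower_bound[OF coE, of x] by (intro mult_left_mono tc(2)) (simp_all add: x)
    finally show ?thesis by simp
  qed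
  then have "norm D \<le> c * norm D"
    using tc(2) by (intro norm_cblinfun_le) simp_all
  then have "(1 - c) * norm D \<le> 0"
    by (simp add: algebra_simps)
  then have "norm D = 0"
    using tc(3) by (simp add: mult_le_0_iff)
  then show ?thesis
    by (simp add: D_def)
qed

text \<open>\<open>op_sqrt\<close> is a definite description, so existence and uniqueness of the
  root together give its defining property.\<close>

lemma strictly_positive_op_inv_sqrt:
  fixes T :: "'a :: chilbert_space \<Rightarrow>\<^sub>C\<^sub>L 'a"
  assumes T: "strictly_positive T"
  shows "strictly_positive (op_inv_sqrt T)"
proof -
  have "\<exists>!S. positive_op S \<and> S o\<^sub>C S = T"
    using ex_sqrt[OF T] sqrt_unique[OF T] by blast
  from theI'[OF this] have "positive_op (op_sqrt T)" "op_sqrt T o\<^sub>C op_sqrt T = T"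
    by (simp_all add: op_sqrt_def)
  then show ?thesis
    unfolding op_inv_sqrt_def by (intro strictly_positive_op_inv strictly_positive_if_square[OF T])
qed

section \<open>The contraction determined by a pair of operators\<close>

context
  fixes W :: "'y :: chilbert_space \<Rightarrow>\<^sub>C\<^sub>L 'z :: chilbert_space"
    and Wt :: "'u :: chilbert_space \<Rightarrow>\<^sub>C\<^sub>L 'z"
    and P \<Lambda> :: "'z \<Rightarrow>\<^sub>C\<^sub>L 'z" and A :: "'u \<Rightarrow>\<^sub>C\<^sub>L 'y"
  assumes P: "P = W o\<^sub>C W\<^sup>\<dagger>"
    and Lambda: "\<Lambda> = W o\<^sub>C W\<^sup>\<dagger> - Wt o\<^sub>C Wt\<^sup>\<dagger>"
    and Lambda_pos: "strictly_positive \<Lambda>"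
    and A: "A = W\<^sup>\<dagger> o\<^sub>C op_inv P o\<^sub>C Wt"
begin

text \<open>\<open>P - \<Lambda> = Wt o\<^sub>C Wt\<^sup>\<dagger>\<close> has a nonnegative form,
  so a coercivity constant of \<Lambda> also serves for \<open>P\<close>.\<close>

lemma gram_coercive: obtains e where "coercive e P"
proof -
  obtain e where e: "coercive e \<Lambda>"
    using Lambda_pos by (rule strictly_positive_coercive)
  have "Re (cinner (\<Lambda> x) x) \<le> Re (cinner (P x) x)" for x
    by (simp add: P Lambda cinner_diff_left cinner_apply_adjoint_left Re_cinner_self)
  then have "coercive e P"
    using e unfolding coercive_def by (meson order_trans)
  then show thesis by (rule that)
qed

lemma strictly_positive_gram: "strictly_positive P"
proof -
  obtain e where "coercive e P"
    by (rule gram_coercive)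
  moreover have "positive_op P"
    by (rule positive_opI)
      (simp_all add: P cadjoint_compose cinner_apply_adjoint_left Re_cinner_self)
  ultimately show ?thesis
    by (intro strictly_positiveI)
qed

text \<open>Applied to vectors, these rules eliminate each adjacent pair \<open>W\<close>,
  \<open>W\<^sup>\<dagger>\<close> and \<open>Wt\<close>, \<open>Wt\<^sup>\<dagger>\<close>,
  reducing the later operator identities to linear algebra in \<open>P\<close>, \<Lambda> and their
  inverses.\<close>

lemma gram_simps:
  "P (op_inv P x) = x" "op_inv P (P x) = x" "\<Lambda> (op_inv \<Lambda> x) = x" "op_inv \<Lambda> (\<Lambda> x) = x"
  "W (W\<^sup>\<dagger> x) = P x" "Wt (Wt\<^sup>\<dagger> x) = P x - \<Lambda> x"
  using strictly_positive_gram Lambda_pos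
  by (simp_all add: strictly_positive_def op_inv_left op_inv_right)
    (simp_all add: P Lambda)

lemma cadjoint_contraction: "A\<^sup>\<dagger> = Wt\<^sup>\<dagger> o\<^sub>C op_inv P o\<^sub>C W"
proof -
  have "(op_inv P)\<^sup>\<dagger> = op_inv P"
    using strictly_positive_op_inv[OF strictly_positive_gram]
    by (simp add: strictly_positive_def positive_op_selfadjoint)
  then show ?thesis
    by (intro cblinfun_eqI) (simp add: A cadjoint_compose)
qed

text \<open>Here \<open>A o\<^sub>C A\<^sup>\<dagger>\<close> is
  \<open>W\<^sup>\<dagger> o\<^sub>C X o\<^sub>C W\<close> with \<open>X = op_inv P - op_inv P
  o\<^sub>C \<Lambda> o\<^sub>C op_inv P\<close>. For \<open>Y = op_inv \<Lambda> - op_inv P\<close>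
  one has \<open>X o\<^sub>C P o\<^sub>C Y = Y - X\<close>, and likewise in the other order.\<close>

lemma op_inv_id_minus_AA:
  "op_inv (id_cblinfun - A o\<^sub>C A\<^sup>\<dagger>) = id_cblinfun + W\<^sup>\<dagger> o\<^sub>C (op_inv \<Lambda> - op_inv P) o\<^sub>C W"
  by (rule op_inv_eqI; simp only: cadjoint_contraction; simp add: A gram_simps)

text \<open>The product \<open>A\<^sup>\<dagger> o\<^sub>C A\<close> collapses to
  \<open>Wt\<^sup>\<dagger> o\<^sub>C op_inv P o\<^sub>C Wt\<close>, and
  \<open>P - \<Lambda>\<close> appears between the two inverses when the factors are
  multiplied.\<close>

lemma op_inv_id_minus_A'A:
  "op_inv (id_cblinfun - A\<^sup>\<dagger> o\<^sub>C A) = id_cblinfun + Wt\<^sup>\<dagger> o\<^sub>C op_inv \<Lambda> o\<^sub>C Wt"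
  by (rule op_inv_eqI; simp only: cadjoint_contraction; simp add: A gram_simps)

text \<open>\<open>V\<close> is kept general: \<open>Wt\<close> yields the inverse of
  \<open>id_cblinfun - A\<^sup>\<dagger> o\<^sub>C A\<close>, and \<open>Bt\<close> yields the
  operator under the root in R.\<close>

lemma strictly_positive_id_plus_pullback:
  fixes V :: "'b :: chilbert_space \<Rightarrow>\<^sub>C\<^sub>L 'z"
  shows "strictly_positive (id_cblinfun + V\<^sup>\<dagger> o\<^sub>C op_inv \<Lambda> o\<^sub>C V)"
  using positive_op_conj[of "op_inv \<Lambda>" "V\<^sup>\<dagger>"] strictly_positive_op_inv[OF Lambda_pos]
  by (intro strictly_positive_id_plus) (simp add: strictly_positive_def)

lemma norm_contraction_less_1: "norm A < 1"
proof -
  have "op_inv (id_cblinfun + Wt\<^sup>\<dagger> o\<^sub>C op_inv \<Lambda> o\<^sub>C Wt) = id_cblinfun - A\<^sup>\<dagger> o\<^sub>C A"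
    by (rule op_inv_eqI; simp only: cadjoint_contraction; simp add: A gram_simps)
  then have "strictly_positive (id_cblinfun - A\<^sup>\<dagger> o\<^sub>C A)"
    using strictly_positive_op_inv[OF strictly_positive_id_plus_pullback[of Wt]] by simp
  then obtain e where e: "coercive e (id_cblinfun - A\<^sup>\<dagger> o\<^sub>C A)"
    by (rule strictly_positive_coercive)
  \<comment> \<open>The minimum keeps the radicand nonnegative: on the zero space a coercivity
    constant may exceed 1.\<close>
  have "norm (A x) \<le> sqrt (1 - min e 1) * norm x" for x
  proof -
    have "min e 1 * (norm x)\<^sup>2 \<le> e * (norm x)\<^sup>2"
      by (intro mult_right_mono) simp_all
    also have "\<dots> \<le> (norm x)\<^sup>2 - (norm (A x))\<^sup>2"
      using e by (simp add: coercive_def cinner_diff_left cinner_adjoint_left Re_cinner_self)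
    finally have "(norm (A x))\<^sup>2 \<le> (1 - min e 1) * (norm x)\<^sup>2"
      by (simp add: algebra_simps)
    also have "\<dots> = (sqrt (1 - min e 1) * norm x)\<^sup>2"
      by (simp add: power_mult_distrib)
    finally show ?thesis
      by (rule power2_le_imp_le) simp
  qed
  then have "norm A \<le> sqrt (1 - min e 1)"
    by (intro norm_cblinfun_le) simp_all
  also have "\<dots> < 1"
    using e by (simp add: coercive_def)
  finally show ?thesis .
qed

text \<open>Since \<open>W\<^sup>\<dagger>\<close> carries \<open>Z\<^sup>\<dagger>\<close> to the
  contraction \<open>S\<^sup>\<dagger>\<close>, the form of \<open>P o\<^sub>C (id_cblinfun -
  \<zeta> *\<^sub>C Z\<^sup>\<dagger>)\<close> at \<open>x\<close> has real part at least
  \<open>(1 - cmod \<zeta>) * (norm (W\<^sup>\<dagger> x))\<^sup>2\<close>, where the squared norm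
  is the form of \<open>P\<close> at \<open>x\<close>.\<close>

lemma op_invertible_resolvent_if_intertwined:
  fixes Z :: "'z \<Rightarrow>\<^sub>C\<^sub>L 'z" and S :: "'y \<Rightarrow>\<^sub>C\<^sub>L 'y"
  assumes ZW: "Z o\<^sub>C W = W o\<^sub>C S" and S: "norm S \<le> 1" and z: "cmod \<zeta> < 1"
  shows "op_invertible (id_cblinfun - \<zeta> *\<^sub>C Z\<^sup>\<dagger>)"
proof (rule op_invertible_if_compose)
  show "op_invertible P"
    using strictly_positive_gram by (simp add: strictly_positive_def)
  obtain e where e: "coercive e P"
    by (rule gram_coercive)
  have "(1 - cmod \<zeta>) * e * (norm x)\<^sup>2 \<le> Re (cinner (P (x - \<zeta> *\<^sub>C Z\<^sup>\<dagger> x)) x)" for x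
  proof -
    have "W\<^sup>\<dagger> (Z\<^sup>\<dagger> x) = S\<^sup>\<dagger> (W\<^sup>\<dagger> x)"
      using ZW by (metis cadjoint_compose cblinfun_compose.rep_eq)
    then have "norm (W\<^sup>\<dagger> (Z\<^sup>\<dagger> x)) \<le> norm (S\<^sup>\<dagger>) * norm (W\<^sup>\<dagger> x)"
      by (simp add: norm_cblinfun_apply_le)
    also have "\<dots> \<le> 1 * norm (W\<^sup>\<dagger> x)"
      using norm_cadjoint_le[of S] S by (intro mult_right_mono) simp_all
    finally have n: "norm (W\<^sup>\<dagger> (Z\<^sup>\<dagger> x)) \<le> norm (W\<^sup>\<dagger> x)" by simp
    have "Re (cinner (\<zeta> *\<^sub>C W\<^sup>\<dagger> (Z\<^sup>\<dagger> x)) (W\<^sup>\<dagger> x)) \<le> norm (\<zeta> *\<^sub>C W\<^sup>\<dagger> (Z\<^sup>\<dagger> x)) * norm (W\<^sup>\<dagger> x)"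
      by (rule Re_cinner_le_norm)
    also have "\<dots> \<le> (cmod \<zeta> * norm (W\<^sup>\<dagger> x)) * norm (W\<^sup>\<dagger> x)"
      unfolding norm_scaleC by (intro mult_right_mono mult_left_mono n) simp_all
    finally have 1: "Re (cinner (\<zeta> *\<^sub>C W\<^sup>\<dagger> (Z\<^sup>\<dagger> x)) (W\<^sup>\<dagger> x)) \<le> cmod \<zeta> * (norm (W\<^sup>\<dagger> x))\<^sup>2"
      by (simp add: power2_eq_square mult.assoc)
    have "(1 - cmod \<zeta>) * (e * (norm x)\<^sup>2) \<le> (1 - cmod \<zeta>) * Re (cinner (P x) x)"
      using e z by (intro mult_left_mono) (simp_all add: coercive_def)
    also have "\<dots> = (norm (W\<^sup>\<dagger> x))\<^sup>2 - cmod \<zeta> * (norm (W\<^sup>\<dagger> x))\<^sup>2"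
      by (simp add: P cinner_apply_adjoint_left Re_cinner_self algebra_simps)
    also have "\<dots> \<le> Re (cinner (P (x - \<zeta> *\<^sub>C Z\<^sup>\<dagger> x)) x)"
      using 1[unfolded cinner_scaleC_left] by (simp add: P cinner_apply_adjoint_left cinner_diff_left cinner_scaleC_left Re_cinner_self)
    finally show ?thesis by (simp add: mult.assoc)
  qed
  then have "coercive ((1 - cmod \<zeta>) * e) (P o\<^sub>C (id_cblinfun - \<zeta> *\<^sub>C Z\<^sup>\<dagger>))"
    using e z by (simp add: coercive_def)
  then show "op_invertible (P o\<^sub>C (id_cblinfun - \<zeta> *\<^sub>C Z\<^sup>\<dagger>))"
    by (rule coercive_op_invertible)
qed

end

section \<open>Resolvents of the backward shift\<close>

lemma norm_ell2_shift_le: "norm (ell2_shift :: 'a :: complex_inner ell2 \<Rightarrow>\<^sub>C\<^sub>L 'a ell2) \<le> 1"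
  by (rule norm_cblinfun_le) (simp_all add: ell2_shift.rep_eq norm_ell2_shift_fun)

lemma cinner_ell2_embed_left: "cinner (ell2_embed v) x = cinner v (ell2_nth x 0)"
proof -
  have "(\<Sum>n. cinner (if n = 0 then v else 0) (ell2_nth x n)) =
      (\<Sum>n\<in>{0}. cinner (if n = 0 then v else 0) (ell2_nth x n))"
    by (rule suminf_finite) auto
  then show ?thesis
    by (simp add: cinner_ell2.rep_eq ell2_embed.rep_eq ell2_embed_fun.rep_eq)
qed

lemma ell2_embed_adjoint_embed: "ell2_embed\<^sup>\<dagger> (ell2_embed v) = v"
  by (rule cinner_ext)
    (simp add: cinner_adjoint_left cinner_ell2_embed_left, simp add: ell2_embed.rep_eq ell2_embed_fun.rep_eq)

text \<open>A shifted sequence has zeroth coordinate 0, so the range of the shift is orthogonal to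
  the embedded copy of the space.\<close>

lemma ell2_shift_adjoint_embed: "ell2_shift\<^sup>\<dagger> (ell2_embed v) = 0"
  by (rule cinner_ext)
    (simp add: cinner_adjoint_left cinner_ell2_embed_left ell2_shift.rep_eq ell2_shift_fun.rep_eq)

lemma op_invertible_id_minus_if_norm_le:
  fixes T :: "'a :: chilbert_space \<Rightarrow>\<^sub>C\<^sub>L 'a"
  assumes T: "norm T \<le> 1" and z: "cmod \<zeta> < 1"
  shows "op_invertible (id_cblinfun - \<zeta> *\<^sub>C T)"
proof (rule coercive_op_invertible)
  have "Re (cinner (\<zeta> *\<^sub>C T x) x) \<le> cmod \<zeta> * (norm x)\<^sup>2" for x
  proof -
    have "norm (T x) \<le> 1 * norm x"
      using T by (intro order_trans[OF norm_cblinfun_apply_le] mult_right_mono) simp_all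
    then have "norm (\<zeta> *\<^sub>C T x) * norm x \<le> (cmod \<zeta> * norm x) * norm x"
      unfolding norm_scaleC by (intro mult_right_mono mult_left_mono) simp_all
    then show ?thesis
      using Re_cinner_le_norm[of "\<zeta> *\<^sub>C T x" x] by (simp add: power2_eq_square mult.assoc)
  qed
  then show "coercive (1 - cmod \<zeta>) (id_cblinfun - \<zeta> *\<^sub>C T)"
    using z by (simp add: coercive_def cinner_diff_left Re_cinner_self algebra_simps)
qed

lemma op_invertible_backward_shift:
  assumes "cmod \<zeta> < 1"
  shows "op_invertible (id_cblinfun - \<zeta> *\<^sub>C ell2_shift\<^sup>\<dagger> :: 'a :: chilbert_space ell2 \<Rightarrow>\<^sub>C\<^sub>L 'a ell2)"
  by (rule op_invertible_id_minus_if_norm_le[OF order_trans[OF norm_cadjoint_le norm_ell2_shift_le] assms])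

lemma op_inv_intertwined:
  fixes T :: "'a :: chilbert_space \<Rightarrow>\<^sub>C\<^sub>L 'b :: chilbert_space"
  assumes "op_invertible V" "op_invertible V'" "\<And>x. T (V x) = V' (T x)"
  shows "T (op_inv V x) = op_inv V' (T x)"
  by (metis assms op_inv_left op_inv_right)

text \<open>The adjoint of the data relation intertwines \<open>Z\<^sup>\<dagger>\<close> with the
  backward shift, and intertwining passes to inverses. It serves for both \<open>W\<close> and
  \<open>Wt\<close>.\<close>

lemma resolvent_intertwined:
  fixes W :: "'y :: chilbert_space ell2 \<Rightarrow>\<^sub>C\<^sub>L 'z :: chilbert_space"
  assumes ZW: "Z o\<^sub>C W = W o\<^sub>C ell2_shift" and z: "cmod \<zeta> < 1"
    and inv: "op_invertible (id_cblinfun - \<zeta> *\<^sub>C Z\<^sup>\<dagger>)"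
  shows "W\<^sup>\<dagger> (op_inv (id_cblinfun - \<zeta> *\<^sub>C Z\<^sup>\<dagger>) x) = op_inv (id_cblinfun - \<zeta> *\<^sub>C ell2_shift\<^sup>\<dagger>) (W\<^sup>\<dagger> x)"
proof (rule op_inv_intertwined[OF inv op_invertible_backward_shift[OF z]])
  have "W\<^sup>\<dagger> (Z\<^sup>\<dagger> x) = ell2_shift\<^sup>\<dagger> (W\<^sup>\<dagger> x)" for x
    using ZW by (metis cadjoint_compose cblinfun_compose.rep_eq)
  then show "W\<^sup>\<dagger> ((id_cblinfun - \<zeta> *\<^sub>C Z\<^sup>\<dagger>) x) = (id_cblinfun - \<zeta> *\<^sub>C ell2_shift\<^sup>\<dagger>) (W\<^sup>\<dagger> x)" for x
    by simp
qed

text \<open>The backward shift kills embedded vectors, so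
  \<open>id_cblinfun - \<zeta> *\<^sub>C ell2_shift\<^sup>\<dagger>\<close> fixes them. This
  accounts for the constant term R of \<Upsilon>22.\<close>

lemma resolvent_embed:
  assumes "cmod \<zeta> < 1"
  shows "op_inv (id_cblinfun - \<zeta> *\<^sub>C ell2_shift\<^sup>\<dagger>) (ell2_embed v) = ell2_embed (v :: 'a :: chilbert_space)"
  using op_inv_left[OF op_invertible_backward_shift[OF assms], of "ell2_embed v"]
  by (simp add: ell2_shift_adjoint_embed scaleC_0_right)

section \<open>Equality of the two families of formulas for \<Upsilon>, Q and R\<close>

theorem theorem1p2:
  fixes W :: "'y :: chilbert_space ell2 \<Rightarrow>\<^sub>C\<^sub>L 'z :: chilbert_space"
    and Wt :: "'u :: chilbert_space ell2 \<Rightarrow>\<^sub>C\<^sub>L 'z"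
    and Z P \<Lambda> :: "'z \<Rightarrow>\<^sub>C\<^sub>L 'z"
    and A :: "'u ell2 \<Rightarrow>\<^sub>C\<^sub>L 'y ell2"
    and B :: "'y \<Rightarrow>\<^sub>C\<^sub>L 'z" and Bt :: "'u \<Rightarrow>\<^sub>C\<^sub>L 'z"
  assumes data: "LTONP_data_set W Wt Z"
    and Lambda: "\<Lambda> = W o\<^sub>C W\<^sup>\<dagger> - Wt o\<^sub>C Wt\<^sup>\<dagger>"
    and Lambda_pos: "strictly_positive \<Lambda>"
    and P: "P = W o\<^sub>C W\<^sup>\<dagger>"
    and A: "A = W\<^sup>\<dagger> o\<^sub>C op_inv P o\<^sub>C Wt"
    and B: "B = W o\<^sub>C ell2_embed"
    and Bt: "Bt = Wt o\<^sub>C ell2_embed"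
  shows "strictly_positive P \<and> norm A < 1 \<and>
    (\<forall>\<zeta>. cmod \<zeta> < 1 \<longrightarrow> op_invertible (id_cblinfun - \<zeta> *\<^sub>C Z\<^sup>\<dagger>)) \<and>
    (\<forall>(C :: 'z \<Rightarrow>\<^sub>C\<^sub>L 'e :: chilbert_space) (D :: 'y \<Rightarrow>\<^sub>C\<^sub>L 'e). admissible_pair W Z C D \<longrightarrow>
      (let
         Q = op_inv_sqrt (id_cblinfun + C o\<^sub>C P o\<^sub>C (op_inv \<Lambda> - op_inv P) o\<^sub>C P o\<^sub>C C\<^sup>\<dagger>);
         R = op_inv_sqrt (id_cblinfun + Bt\<^sup>\<dagger> o\<^sub>C op_inv \<Lambda> o\<^sub>C Bt);
         \<Upsilon>11 = (\<lambda>\<zeta>. D\<^sup>\<dagger> o\<^sub>C Q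
           + \<zeta> *\<^sub>C (B\<^sup>\<dagger> o\<^sub>C op_inv (id_cblinfun - \<zeta> *\<^sub>C Z\<^sup>\<dagger>) o\<^sub>C op_inv \<Lambda> o\<^sub>C P o\<^sub>C C\<^sup>\<dagger> o\<^sub>C Q));
         \<Upsilon>12 = (\<lambda>\<zeta>. B\<^sup>\<dagger> o\<^sub>C op_inv (id_cblinfun - \<zeta> *\<^sub>C Z\<^sup>\<dagger>) o\<^sub>C op_inv \<Lambda> o\<^sub>C Bt o\<^sub>C R);
         \<Upsilon>21 = (\<lambda>\<zeta>. \<zeta> *\<^sub>C
           (Bt\<^sup>\<dagger> o\<^sub>C op_inv (id_cblinfun - \<zeta> *\<^sub>C Z\<^sup>\<dagger>) o\<^sub>C op_inv \<Lambda> o\<^sub>C P o\<^sub>C C\<^sup>\<dagger> o\<^sub>C Q));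
         \<Upsilon>22 = (\<lambda>\<zeta>. R + Bt\<^sup>\<dagger> o\<^sub>C op_inv (id_cblinfun - \<zeta> *\<^sub>C Z\<^sup>\<dagger>) o\<^sub>C op_inv \<Lambda> o\<^sub>C Bt o\<^sub>C R)
       in
         (\<forall>\<zeta>. cmod \<zeta> < 1 \<longrightarrow>
           \<Upsilon>11 \<zeta> = D\<^sup>\<dagger> o\<^sub>C Q
             + \<zeta> *\<^sub>C (ell2_embed\<^sup>\<dagger> o\<^sub>C op_inv (id_cblinfun - \<zeta> *\<^sub>C ell2_shift\<^sup>\<dagger>)
                 o\<^sub>C op_inv (id_cblinfun - A o\<^sub>C A\<^sup>\<dagger>) o\<^sub>C W\<^sup>\<dagger> o\<^sub>C C\<^sup>\<dagger> o\<^sub>C Q) \<and>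
           \<Upsilon>12 \<zeta> = ell2_embed\<^sup>\<dagger> o\<^sub>C op_inv (id_cblinfun - \<zeta> *\<^sub>C ell2_shift\<^sup>\<dagger>)
               o\<^sub>C A o\<^sub>C op_inv (id_cblinfun - A\<^sup>\<dagger> o\<^sub>C A) o\<^sub>C ell2_embed o\<^sub>C R \<and>
           \<Upsilon>21 \<zeta> = \<zeta> *\<^sub>C (ell2_embed\<^sup>\<dagger> o\<^sub>C op_inv (id_cblinfun - \<zeta> *\<^sub>C ell2_shift\<^sup>\<dagger>)
               o\<^sub>C A\<^sup>\<dagger> o\<^sub>C op_inv (id_cblinfun - A o\<^sub>C A\<^sup>\<dagger>) o\<^sub>C W\<^sup>\<dagger> o\<^sub>C C\<^sup>\<dagger> o\<^sub>C Q) \<and>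
           \<Upsilon>22 \<zeta> = ell2_embed\<^sup>\<dagger> o\<^sub>C op_inv (id_cblinfun - \<zeta> *\<^sub>C ell2_shift\<^sup>\<dagger>)
               o\<^sub>C op_inv (id_cblinfun - A\<^sup>\<dagger> o\<^sub>C A) o\<^sub>C ell2_embed o\<^sub>C R) \<and>
         strictly_positive Q \<and> strictly_positive R \<and>
         Q = op_inv_sqrt
           (id_cblinfun + C o\<^sub>C W o\<^sub>C A o\<^sub>C op_inv (id_cblinfun - A\<^sup>\<dagger> o\<^sub>C A) o\<^sub>C A\<^sup>\<dagger> o\<^sub>C W\<^sup>\<dagger> o\<^sub>C C\<^sup>\<dagger>) \<and>
         R = op_inv_sqrt (ell2_embed\<^sup>\<dagger> o\<^sub>C op_inv (id_cblinfun - A\<^sup>\<dagger> o\<^sub>C A) o\<^sub>C ell2_embed)))"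
proof -
  note setting = P Lambda Lambda_pos A
  note simps = gram_simps[OF setting] op_inv_id_minus_AA[OF setting] op_inv_id_minus_A'A[OF setting]
  have ZW: "Z o\<^sub>C W = W o\<^sub>C ell2_shift" and ZWt: "Z o\<^sub>C Wt = Wt o\<^sub>C ell2_shift"
    using data by (simp_all add: LTONP_data_set_def)
  have inv: "op_invertible (id_cblinfun - \<zeta> *\<^sub>C Z\<^sup>\<dagger>)" if "cmod \<zeta> < 1" for \<zeta>
    by (rule op_invertible_resolvent_if_intertwined[OF setting ZW norm_ell2_shift_le that])
  have res: "W\<^sup>\<dagger> (op_inv (id_cblinfun - \<zeta> *\<^sub>C Z\<^sup>\<dagger>) x) = op_inv (id_cblinfun - \<zeta> *\<^sub>C ell2_shift\<^sup>\<dagger>) (W\<^sup>\<dagger> x)"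
      "Wt\<^sup>\<dagger> (op_inv (id_cblinfun - \<zeta> *\<^sub>C Z\<^sup>\<dagger>) x) = op_inv (id_cblinfun - \<zeta> *\<^sub>C ell2_shift\<^sup>\<dagger>) (Wt\<^sup>\<dagger> x)"
    if "cmod \<zeta> < 1" for \<zeta> x
    by (rule resolvent_intertwined[OF ZW that inv[OF that]]
        resolvent_intertwined[OF ZWt that inv[OF that]])+
  have applied: "A u = W\<^sup>\<dagger> (op_inv P (Wt u))" "Bt v = Wt (ell2_embed v)"
      "B\<^sup>\<dagger> x = ell2_embed\<^sup>\<dagger> (W\<^sup>\<dagger> x)" "Bt\<^sup>\<dagger> x = ell2_embed\<^sup>\<dagger> (Wt\<^sup>\<dagger> x)"
      "A\<^sup>\<dagger> y = Wt\<^sup>\<dagger> (op_inv P (W y))" for u v x y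
    by (simp_all only: cadjoint_contraction[OF setting]) (simp_all add: A B Bt cadjoint_compose)
  \<comment> \<open>The identity term arises as
    \<open>ell2_embed\<^sup>\<dagger> o\<^sub>C ell2_embed\<close>, the embedding being
    isometric.\<close>
  have R: "id_cblinfun + Bt\<^sup>\<dagger> o\<^sub>C op_inv \<Lambda> o\<^sub>C Bt =
      ell2_embed\<^sup>\<dagger> o\<^sub>C op_inv (id_cblinfun - A\<^sup>\<dagger> o\<^sub>C A) o\<^sub>C ell2_embed"
    by (rule cblinfun_eqI) (simp add: simps applied ell2_embed_adjoint_embed)
  have Q: "id_cblinfun + C o\<^sub>C P o\<^sub>C (op_inv \<Lambda> - op_inv P) o\<^sub>C P o\<^sub>C C\<^sup>\<dagger> =
      id_cblinfun + C o\<^sub>C W o\<^sub>C A o\<^sub>C op_inv (id_cblinfun - A\<^sup>\<dagger> o\<^sub>C A) o\<^sub>C A\<^sup>\<dagger> o\<^sub>C W\<^sup>\<dagger> o\<^sub>C C\<^sup>\<dagger>"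
    for C :: "'z \<Rightarrow>\<^sub>C\<^sub>L 'e"
    by (rule cblinfun_eqI) (simp add: simps applied)
  have R_pos: "strictly_positive (id_cblinfun + Bt\<^sup>\<dagger> o\<^sub>C op_inv \<Lambda> o\<^sub>C Bt)"
    by (rule strictly_positive_id_plus_pullback[OF setting])
  have Q_pos: "strictly_positive (id_cblinfun + C o\<^sub>C P o\<^sub>C (op_inv \<Lambda> - op_inv P) o\<^sub>C P o\<^sub>C C\<^sup>\<dagger>)"
    for C :: "'z \<Rightarrow>\<^sub>C\<^sub>L 'e"
  proof (rule strictly_positive_id_plus)
    \<comment> \<open>Positivity becomes visible by writing
      \<open>P o\<^sub>C (op_inv \<Lambda> - op_inv P) o\<^sub>C P\<close> as \<open>Wt o\<^sub>C
      (id_cblinfun + Wt\<^sup>\<dagger> o\<^sub>C op_inv \<Lambda> o\<^sub>C Wt) o\<^sub>C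
      Wt\<^sup>\<dagger>\<close>; both equal
      \<open>P o\<^sub>C op_inv \<Lambda> o\<^sub>C P - P\<close>.\<close>
    have "positive_op (id_cblinfun + Wt\<^sup>\<dagger> o\<^sub>C op_inv \<Lambda> o\<^sub>C Wt)"
      using strictly_positive_id_plus_pullback[OF setting, of Wt] by (simp add: strictly_positive_def)
    from positive_op_conj[OF this, of "C o\<^sub>C Wt"]
    show "positive_op (C o\<^sub>C P o\<^sub>C (op_inv \<Lambda> - op_inv P) o\<^sub>C P o\<^sub>C C\<^sup>\<dagger>)"
      by (rule back_subst[where P = positive_op])
        (rule cblinfun_eqI, simp add: cadjoint_compose simps)
  qed
  \<comment> \<open>After the resolvent is moved across \<open>W\<^sup>\<dagger>\<close> or
    \<open>Wt\<^sup>\<dagger>\<close>, the first three identities reduce to \<open>op_inv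
    (id_cblinfun - A o\<^sub>C A\<^sup>\<dagger>) o\<^sub>C W\<^sup>\<dagger> = W\<^sup>\<dagger>
    o\<^sub>C op_inv \<Lambda> o\<^sub>C P\<close> and \<open>A o\<^sub>C op_inv (id_cblinfun -
    A\<^sup>\<dagger> o\<^sub>C A) = W\<^sup>\<dagger> o\<^sub>C op_inv \<Lambda> o\<^sub>C
    Wt\<close>. In the fourth, \<open>V\<close> stands for R.\<close>
  have U: "B\<^sup>\<dagger> o\<^sub>C op_inv (id_cblinfun - \<zeta> *\<^sub>C Z\<^sup>\<dagger>) o\<^sub>C op_inv \<Lambda> o\<^sub>C P =
        ell2_embed\<^sup>\<dagger> o\<^sub>C op_inv (id_cblinfun - \<zeta> *\<^sub>C ell2_shift\<^sup>\<dagger>) o\<^sub>C op_inv (id_cblinfun - A o\<^sub>C A\<^sup>\<dagger>) o\<^sub>C W\<^sup>\<dagger>"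
      "B\<^sup>\<dagger> o\<^sub>C op_inv (id_cblinfun - \<zeta> *\<^sub>C Z\<^sup>\<dagger>) o\<^sub>C op_inv \<Lambda> o\<^sub>C Bt =
        ell2_embed\<^sup>\<dagger> o\<^sub>C op_inv (id_cblinfun - \<zeta> *\<^sub>C ell2_shift\<^sup>\<dagger>)
          o\<^sub>C A o\<^sub>C op_inv (id_cblinfun - A\<^sup>\<dagger> o\<^sub>C A) o\<^sub>C ell2_embed"
      "Bt\<^sup>\<dagger> o\<^sub>C op_inv (id_cblinfun - \<zeta> *\<^sub>C Z\<^sup>\<dagger>) o\<^sub>C op_inv \<Lambda> o\<^sub>C P =
        ell2_embed\<^sup>\<dagger> o\<^sub>C op_inv (id_cblinfun - \<zeta> *\<^sub>C ell2_shift\<^sup>\<dagger>)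
          o\<^sub>C A\<^sup>\<dagger> o\<^sub>C op_inv (id_cblinfun - A o\<^sub>C A\<^sup>\<dagger>) o\<^sub>C W\<^sup>\<dagger>"
      "V + Bt\<^sup>\<dagger> o\<^sub>C op_inv (id_cblinfun - \<zeta> *\<^sub>C Z\<^sup>\<dagger>) o\<^sub>C op_inv \<Lambda> o\<^sub>C Bt o\<^sub>C V =
        ell2_embed\<^sup>\<dagger> o\<^sub>C op_inv (id_cblinfun - \<zeta> *\<^sub>C ell2_shift\<^sup>\<dagger>)
          o\<^sub>C op_inv (id_cblinfun - A\<^sup>\<dagger> o\<^sub>C A) o\<^sub>C ell2_embed o\<^sub>C V"
    if "cmod \<zeta> < 1" for \<zeta> and V :: "'u \<Rightarrow>\<^sub>C\<^sub>L 'u"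
    by (rule cblinfun_eqI;
        simp add: simps applied res ell2_embed_adjoint_embed resolvent_embed that)+
  show ?thesis
    unfolding Let_def
    by (intro conjI allI impI strictly_positive_gram[OF setting]
        norm_contraction_less_1[OF setting] inv strictly_positive_op_inv_sqrt Q_pos R_pos)
      (simp_all only: U Q R)
qed

end
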